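(* For any $\epsilon>0$, there exists a polynomial-time randomized $(1+\epsilon)$-approximation algorithm for the minimum spanning tree problem whose Lipschitz constant is $O(\epsilon^{-1})$ on every input graph.
   Context: Minimum spanning tree problem: given a connected undirected graph $G=(V,E)$ and $w\in\mathbb{R}_{\geq0}^E$, output a spanning tree $T\subseteq E$ minimizing $\sum_{e\in T}w(e)$. A randomized algorithm is a $(1+\epsilon)$-approximation if its output is a spanning tree of weight at most $(1+\epsilon)$ times the optimum. For edge sets $F,F'$ and weight vectors $w,w'$, $d_w((F,w),(F',w'))=\bigl\|\sum_{e\in F}w(e)\mathbf{1}_e-\sum_{e\in F'}w'(e)\mathbf{1}_e\bigr\|_1$ ($\mathbf{1}_e$ the indicator vector of $e$); for output distributions, $\mathrm{EM}_\mathrm{w}((\mathcal{F},w),(\mathcal{F}',w'))$ is the minimum over couplings of $\mathcal{F},\mathcal{F}'$ of the expected $d_w$. The Lipschitz constant of a randomized algorithm $\mathcal{A}$ on $G$ is $\sup_{w\neq w'\in\mathbb{R}_{\geq0}^E}\mathrm{EM}_\mathrm{w}((\mathcal{A}(G,w),w),(\mathcal{A}(G,w'),w'))/\|w-w'\|_1$. "$O(\epsilon^{-1})$" means bounded by $C/\epsilon$ for an absolute constant $C$ (for $\epsilon$ in the relevant range), independently of $G$. *)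

theory Defs
  imports "HOL-Probability.Probability" "HOL-Computational_Algebra.Polynomial"
begin

section \<open>Graphs and spanning trees\<close>

definition simple_graph :: "'v set \<Rightarrow> 'v set set \<Rightarrow> bool" where
  "simple_graph V E \<longleftrightarrow> finite V \<and> E \<subseteq> {{u, v} | u v. u \<in> V \<and> v \<in> V \<and> u \<noteq> v}"

definition graph_connected :: "'v set \<Rightarrow> 'v set set \<Rightarrow> bool" where
  "graph_connected V E \<longleftrightarrow> V \<noteq> {} \<and> (\<forall>u\<in>V. \<forall>v\<in>V. (u, v) \<in> {(x, y). {x, y} \<in> E}\<^sup>*)"

definition graph_cycle :: "'v set set \<Rightarrow> 'v list \<Rightarrow> bool" where
  "graph_cycle E vs \<longleftrightarrow> 3 \<le> length vs \<and> distinct vs \<and>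
     (\<forall>i<length vs. {vs ! i, vs ! (Suc i mod length vs)} \<in> E)"

definition spanning_tree :: "'v set \<Rightarrow> 'v set set \<Rightarrow> 'v set set \<Rightarrow> bool" where
  "spanning_tree V E T \<longleftrightarrow> T \<subseteq> E \<and> graph_connected V T \<and> (\<nexists>vs. graph_cycle T vs)"

definition mst_opt :: "'v set \<Rightarrow> 'v set set \<Rightarrow> ('v set \<Rightarrow> real) \<Rightarrow> real" where
  "mst_opt V E w = Min ((\<lambda>T. \<Sum>e\<in>T. w e) ` {T. spanning_tree V E T})"

text \<open>The orthant of nonnegative vectors in the real space indexed by \<open>E\<close>; by
  extensionality two members are equal iff they agree on \<open>E\<close>.\<close>

definition weight_vectors :: "'e set \<Rightarrow> ('e \<Rightarrow> real) set" where
  "weight_vectors E = E \<rightarrow>\<^sub>E {0..}"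

section \<open>Lipschitz constants\<close>

definition dist_w ::
  "'e set \<Rightarrow> 'e set \<Rightarrow> ('e \<Rightarrow> real) \<Rightarrow> 'e set \<Rightarrow> ('e \<Rightarrow> real) \<Rightarrow> real" where
  "dist_w E F w F' w' = (\<Sum>e\<in>E. \<bar>w e * indicator F e - w' e * indicator F' e\<bar>)"

definition couplings :: "'a pmf \<Rightarrow> 'b pmf \<Rightarrow> ('a \<times> 'b) pmf set" where
  "couplings p q = {\<pi>. map_pmf fst \<pi> = p \<and> map_pmf snd \<pi> = q}"

definition EM_w ::
  "'e set \<Rightarrow> 'e set pmf \<Rightarrow> ('e \<Rightarrow> real) \<Rightarrow> 'e set pmf \<Rightarrow> ('e \<Rightarrow> real) \<Rightarrow> ennreal" where
  "EM_w E D w D' w' =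
     (INF \<pi>\<in>couplings D D'. \<integral>\<^sup>+ (F, F'). ennreal (dist_w E F w F' w') \<partial>measure_pmf \<pi>)"

definition lipschitz_const :: "'e set \<Rightarrow> (('e \<Rightarrow> real) \<Rightarrow> 'e set pmf) \<Rightarrow> ennreal" where
  "lipschitz_const E A =
     (SUP (w, w') \<in> {(w, w'). w \<in> weight_vectors E \<and> w' \<in> weight_vectors E \<and> w \<noteq> w'}.
        EM_w E (A w) w (A w') w' / ennreal (\<Sum>e\<in>E. \<bar>w e - w' e\<bar>))"

section \<open>Randomized real-RAM programs\<close>

text \<open>
  Structured programs over finitely many unbounded arrays of natural numbers and of reals
  (a scalar variable is an array cell), with unit cost for exact real arithmetic, real
  comparison and drawing a uniform sample from the unit interval. To keep the unit-cost measure
  honest, naturals can only be added and subtracted, there is no rounding of reals,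
  and only rational constants are allowed. Expressions need not be charged by size, since their
  size is bounded for a fixed program.
\<close>

datatype nexp =
    NConst nat
  | NCell nat nexp
  | NAdd nexp nexp
  | NSub nexp nexp

datatype rexp =
    RConst rat
  | RCell nat nexp
  | RAdd rexp rexp
  | RSub rexp rexp
  | RMul rexp rexp
  | RDiv rexp rexp

datatype bexp =
    NLess nexp nexp
  | RLess rexp rexp
  | BNot bexp
  | BAnd bexp bexp

datatype com =
    Skip
  | NAssign nat nexp nexp
  | RAssign nat nexp rexp
  | RSample nat nexp
  | Seq com com
  | Cond bexp com com
  | While bexp com

record state =
  nmem :: "nat \<Rightarrow> nat \<Rightarrow> nat"
  rmem :: "nat \<Rightarrow> nat \<Rightarrow> real"
  tpos :: nat

fun nval :: "nexp \<Rightarrow> state \<Rightarrow> nat" where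
  "nval (NConst k) s = k"
| "nval (NCell a i) s = nmem s a (nval i s)"
| "nval (NAdd x y) s = nval x s + nval y s"
| "nval (NSub x y) s = nval x s - nval y s"

fun rval :: "rexp \<Rightarrow> state \<Rightarrow> real" where
  "rval (RConst q) s = of_rat q"
| "rval (RCell a i) s = rmem s a (nval i s)"
| "rval (RAdd x y) s = rval x s + rval y s"
| "rval (RSub x y) s = rval x s - rval y s"
| "rval (RMul x y) s = rval x s * rval y s"
| "rval (RDiv x y) s = rval x s / rval y s"

fun bval :: "bexp \<Rightarrow> state \<Rightarrow> bool" where
  "bval (NLess x y) s \<longleftrightarrow> nval x s < nval y s"
| "bval (RLess x y) s \<longleftrightarrow> rval x s < rval y s"
| "bval (BNot b) s \<longleftrightarrow> \<not> bval b s"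
| "bval (BAnd b c) s \<longleftrightarrow> bval b s \<and> bval c s"

definition set_cell :: "(nat \<Rightarrow> nat \<Rightarrow> 'a) \<Rightarrow> nat \<Rightarrow> nat \<Rightarrow> 'a \<Rightarrow> nat \<Rightarrow> nat \<Rightarrow> 'a" where
  "set_cell m a i x = m(a := (m a)(i := x))"

text \<open>\<open>exec \<omega> c s t s'\<close>: started in \<open>s\<close> with random tape \<open>\<omega>\<close>, the program \<open>c\<close> halts in \<open>s'\<close>
  after \<open>t\<close> steps.\<close>

inductive exec :: "(nat \<Rightarrow> real) \<Rightarrow> com \<Rightarrow> state \<Rightarrow> nat \<Rightarrow> state \<Rightarrow> bool" for \<omega> where
  Skip: "exec \<omega> Skip s 1 s"
| NAssign: "exec \<omega> (NAssign a i x) s 1 (s\<lparr>nmem := set_cell (nmem s) a (nval i s) (nval x s)\<rparr>)"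
| RAssign: "exec \<omega> (RAssign a i x) s 1 (s\<lparr>rmem := set_cell (rmem s) a (nval i s) (rval x s)\<rparr>)"
| RSample: "exec \<omega> (RSample a i) s 1
     (s\<lparr>rmem := set_cell (rmem s) a (nval i s) (\<omega> (tpos s)), tpos := Suc (tpos s)\<rparr>)"
| Seq: "exec \<omega> c s t s' \<Longrightarrow> exec \<omega> d s' u s'' \<Longrightarrow> exec \<omega> (Seq c d) s (t + u) s''"
| CondT: "bval b s \<Longrightarrow> exec \<omega> c s t s' \<Longrightarrow> exec \<omega> (Cond b c d) s (Suc t) s'"
| CondF: "\<not> bval b s \<Longrightarrow> exec \<omega> d s t s' \<Longrightarrow> exec \<omega> (Cond b c d) s (Suc t) s'"
| WhileF: "\<not> bval b s \<Longrightarrow> exec \<omega> (While b c) s 1 s"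
| WhileT: "bval b s \<Longrightarrow> exec \<omega> c s t s' \<Longrightarrow> exec \<omega> (While b c) s' u s'' \<Longrightarrow>
     exec \<omega> (While b c) s (Suc (t + u)) s''"

inductive_cases SkipE: "exec \<omega> Skip s t s'"
inductive_cases NAssignE: "exec \<omega> (NAssign a i x) s t s'"
inductive_cases RAssignE: "exec \<omega> (RAssign a i x) s t s'"
inductive_cases RSampleE: "exec \<omega> (RSample a i) s t s'"
inductive_cases SeqE: "exec \<omega> (Seq c d) s t s'"
inductive_cases CondE: "exec \<omega> (Cond b c d) s t s'"
inductive_cases WhileE: "exec \<omega> (While b c) s t s'"

lemma exec_deterministic:
  "exec \<omega> c s t s' \<Longrightarrow> exec \<omega> c s u s'' \<Longrightarrow> t = u \<and> s' = s''"
proof (induction arbitrary: u s'' rule: exec.induct)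
  case (Seq c s t s' d u' s3)
  from Seq.prems show ?case by (rule SeqE) (use Seq.IH in blast)
next
  case (WhileT b s c t s' u' s3)
  from WhileT.prems show ?case by (rule WhileE) (use WhileT.IH WhileT.hyps in blast)+
next
  case (WhileF b s c)
  from WhileF.prems show ?case by (rule WhileE) (use WhileF.hyps in simp_all)
next
  case (CondT b s c t s' d)
  from CondT.prems show ?case by (rule CondE) (use CondT.IH CondT.hyps in blast)+
next
  case (CondF b s d t s' c)
  from CondF.prems show ?case by (rule CondE) (use CondF.IH CondF.hyps in blast)+
qed (erule SkipE NAssignE RAssignE RSampleE; simp)+

section \<open>Algorithms on weighted graphs\<close>

definition pair_edge :: "nat \<times> nat \<Rightarrow> nat set" where
  "pair_edge p = {fst p, snd p}"

text \<open>An input graph is a connected simple graph on the vertices \<open>0, \<dots>, n - 1\<close>, presented to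
  a program as a list of its edges in arbitrary order and orientation.\<close>

definition input_graph :: "nat \<Rightarrow> nat set set \<Rightarrow> (nat \<times> nat) list \<Rightarrow> bool" where
  "input_graph n E es \<longleftrightarrow> simple_graph {..<n} E \<and> graph_connected {..<n} E \<and>
     distinct (map pair_edge es) \<and> set (map pair_edge es) = E"

definition init_state :: "nat \<Rightarrow> (nat \<times> nat) list \<Rightarrow> (nat set \<Rightarrow> real) \<Rightarrow> state" where
  "init_state n es w =
     \<lparr>nmem = (\<lambda>a i.
        if a = 0 then (if i = 0 then n else if i = 1 then length es else 0)
        else if a = 1 \<and> i < length es then fst (es ! i)
        else if a = 2 \<and> i < length es then snd (es ! i)
        else 0),
      rmem = (\<lambda>a i. if a = 0 \<and> i < length es then w (pair_edge (es ! i)) else 0),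
      tpos = 0\<rparr>"

text \<open>On halting, the output is read off the fourth array of naturals, as a 0/1-vector.\<close>

definition output_edges :: "(nat \<times> nat) list \<Rightarrow> state \<Rightarrow> nat set set" where
  "output_edges es s = {pair_edge (es ! i) | i. i < length es \<and> nmem s 3 i \<noteq> 0}"

definition random_tape :: "(nat \<Rightarrow> real) measure" where
  "random_tape = (\<Pi>\<^sub>M i\<in>UNIV. uniform_measure lborel {0..1})"

text \<open>The probabilities below sum to 1 whenever the program halts on every tape with entries in
  the unit interval; only such programs are considered.\<close>

definition output_pmf ::
  "com \<Rightarrow> nat \<Rightarrow> (nat \<times> nat) list \<Rightarrow> (nat set \<Rightarrow> real) \<Rightarrow> nat set set pmf" where
  "output_pmf P n es w = embed_pmf (\<lambda>F. measure random_tape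
     {\<omega> \<in> space random_tape. \<exists>t s. exec \<omega> P (init_state n es w) t s \<and> output_edges es s = F})"

definition polynomial_time :: "com \<Rightarrow> bool" where
  "polynomial_time P \<longleftrightarrow> (\<exists>p :: nat poly. \<forall>n E es w \<omega>.
     input_graph n E es \<longrightarrow> w \<in> weight_vectors E \<longrightarrow> range \<omega> \<subseteq> {0..1} \<longrightarrow>
     (\<exists>t s. exec \<omega> P (init_state n es w) t s \<and> t \<le> poly p (n + length es)))"

definition mst_approximation :: "real \<Rightarrow> com \<Rightarrow> bool" where
  "mst_approximation \<alpha> P \<longleftrightarrow> (\<forall>n E es w.
     input_graph n E es \<longrightarrow> w \<in> weight_vectors E \<longrightarrow>
     (\<forall>T \<in> set_pmf (output_pmf P n es w).
        spanning_tree {..<n} E T \<and> (\<Sum>e\<in>T. w e) \<le> \<alpha> * mst_opt {..<n} E w))"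

end

theory Submission
  imports Defs
begin

text \<open>
  The algorithm multiplies every weight by an independent uniform factor from \<open>[1, 1 + q]\<close> and
  returns a minimum spanning tree for the resulting keys, so a tree that is optimal for the keys is
  optimal up to the factor \<open>1 + q\<close> for the weights.

  For the Lipschitz bound, run the algorithm on \<open>w\<close> and \<open>w'\<close> with the same random tape. By the
  triangle inequality the weights may be changed one coordinate \<open>f\<close> at a time, say from \<open>a\<close> to
  \<open>b \<ge> a\<close>. Raising the key of \<open>f\<close> either preserves the tree or replaces \<open>f\<close> by an edge whose
  key, and hence weight, is at most the new key of \<open>f\<close>, at a cost of at most \<open>3 b\<close>. With all other
  factors fixed, \<open>f\<close> is in the tree iff its key is below a threshold, so the factors of \<open>f\<close>
  for which this replacement occurs lie in an interval, of probability \<open>O((b - a) / (a q))\<close>. The expected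
  cost is therefore \<open>O((b - a) / q)\<close>; for \<open>b \<ge> 2 a\<close> this holds trivially.
\<close>

section \<open>Greedy bases of a matroid given by its closure operator\<close>

text \<open>Ties between keys are broken by index, so this is a strict linear order for every
  \<open>k\<close>. Ties do occur: all edges of weight zero have key zero, whatever their
  factors.\<close>

definition prec :: "(nat \<Rightarrow> real) \<Rightarrow> nat \<Rightarrow> nat \<Rightarrow> bool" where
  "prec k j i \<longleftrightarrow> k j < k i \<or> (k j = k i \<and> j < i)"

lemma prec_irrefl [simp]: "\<not> prec k i i"
  by (simp add: prec_def)

lemma prec_trans: "prec k a b \<Longrightarrow> prec k b c \<Longrightarrow> prec k a c"
  by (auto simp: prec_def)

lemma prec_linear: "a \<noteq> b \<Longrightarrow> \<not> prec k a b \<Longrightarrow> prec k b a"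
  by (auto simp: prec_def)

text \<open>\<open>cl_hull\<close> packs monotonicity and idempotence of the closure into one axiom;
  \<open>cl_exchange\<close> is the Mac Lane-Steinitz exchange property.\<close>

locale closure_matroid =
  fixes m :: nat and cl :: "nat set \<Rightarrow> nat set"
  assumes cl_extensive: "A \<subseteq> {..<m} \<Longrightarrow> A \<subseteq> cl A"
    and cl_hull: "A \<subseteq> cl B \<Longrightarrow> B \<subseteq> {..<m} \<Longrightarrow> cl A \<subseteq> cl B"
    and cl_exchange: "i \<in> cl (insert f A) \<Longrightarrow> i \<notin> cl A \<Longrightarrow> insert f A \<subseteq> {..<m} \<Longrightarrow> i < m
      \<Longrightarrow> f \<in> cl (insert i A)"
begin

lemma cl_mono: "A \<subseteq> B \<Longrightarrow> B \<subseteq> {..<m} \<Longrightarrow> cl A \<subseteq> cl B"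
  using cl_hull cl_extensive by blast

definition below :: "(nat \<Rightarrow> real) \<Rightarrow> nat \<Rightarrow> nat set" where
  "below k i = {j. j < m \<and> prec k j i}"

text \<open>Kruskal's basis without recursion: an element is tested against all its predecessors
  rather than the accepted ones, which span the same set. Membership of \<open>i\<close> thus
  depends on \<open>below k i\<close> alone.\<close>

definition greedy :: "(nat \<Rightarrow> real) \<Rightarrow> nat set" where
  "greedy k = {i. i < m \<and> i \<notin> cl (below k i)}"

lemma below_subset: "below k i \<subseteq> {..<m}"
  by (auto simp: below_def)

lemma finite_below [simp]: "finite (below k i)"
  using below_subset finite_subset by blast

lemma greedy_subset: "greedy k \<subseteq> {..<m}"
  by (auto simp: greedy_def)

lemma finite_greedy [simp]: "finite (greedy k)"
  using greedy_subset finite_subset by blast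

lemma card_below_less:
  assumes "prec k a b" "a < m"
  shows "card (below k a) < card (below k b)"
proof (rule psubset_card_mono)
  have "a \<in> below k b" "a \<notin> below k a"
    using assms by (auto simp: below_def)
  moreover have "below k a \<subseteq> below k b"
    using assms prec_trans by (auto simp: below_def)
  ultimately show "below k a \<subset> below k b" by blast
qed simp

text \<open>By induction on the rank of \<open>i\<close>: a rejected element lies in the closure of
  its predecessors, which the greedy set already spans.\<close>

lemma greedy_spans: "{..<m} \<subseteq> cl (greedy k)"
proof -
  have "i < m \<longrightarrow> i \<in> cl (greedy k)" for i
  proof (induction i rule: measure_induct_rule[where f = "\<lambda>i. card (below k i)"])
    case (less i)
    show ?case
    proof (cases "i \<in> greedy k")
      case True
      then show ?thesis using cl_extensive[OF greedy_subset] by blast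
    next
      case False
      have "below k i \<subseteq> cl (greedy k)"
        using less card_below_less by (auto simp: below_def)
      then show ?thesis
        using False cl_hull[OF _ greedy_subset] by (auto simp: greedy_def)
    qed
  qed
  then show ?thesis by blast
qed

text \<open>A smallest \<open>R\<close> inside \<open>S\<close> that spans \<open>e\<close> cannot
  consist of predecessors of \<open>e\<close> only, as \<open>e\<close> was accepted; so it has some
  later \<open>f\<close>. By minimality \<open>e\<close> depends on \<open>f\<close>, and exchange
  allows \<open>f\<close> to be replaced by \<open>e\<close>.\<close>

lemma exchange_step:
  assumes S: "S \<subseteq> {..<m}" "{..<m} \<subseteq> cl S" and e: "e \<in> greedy k" "e \<notin> S"
  obtains f where "f \<in> S" "prec k e f" "{..<m} \<subseteq> cl (insert e (S - {f}))"
proof -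
  have em: "e < m" using e greedy_subset by blast
  have fin: "finite S" using S finite_subset by blast
  have "S \<subseteq> S \<and> e \<in> cl S" using S em by blast
  from ex_has_least_nat[of "\<lambda>R. R \<subseteq> S \<and> e \<in> cl R", OF this, of card]
  obtain R where R: "R \<subseteq> S" "e \<in> cl R"
    and Rmin: "\<And>R'. R' \<subseteq> S \<Longrightarrow> e \<in> cl R' \<Longrightarrow> card R \<le> card R'"
    by (elim exE conjE) simp
  have finR: "finite R" using R fin finite_subset by blast
  have "\<not> R \<subseteq> below k e"
    using e(1) R(2) cl_mono[OF _ below_subset, of R k e] by (auto simp: greedy_def)
  then obtain f where f: "f \<in> R" "f \<notin> below k e" by blast
  have "f \<noteq> e" using f R e by blast
  then have "prec k e f"
    using f R S prec_linear[of f e k] by (auto simp: below_def)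
  have "e \<notin> cl (R - {f})"
  proof
    assume "e \<in> cl (R - {f})"
    then have "card R \<le> card (R - {f})" using Rmin R by blast
    then show False
      using card_Diff1_less[OF finR f(1)] by simp
  qed
  moreover have "insert f (R - {f}) = R" using f by blast
  ultimately have "f \<in> cl (insert e (R - {f}))"
    using cl_exchange[of e f "R - {f}"] R S em by auto
  moreover have sub: "insert e (S - {f}) \<subseteq> {..<m}" using S em by blast
  ultimately have "f \<in> cl (insert e (S - {f}))"
    using cl_mono[of "insert e (R - {f})" "insert e (S - {f})"] R by blast
  then have "S \<subseteq> cl (insert e (S - {f}))"
    using cl_extensive[OF sub] by blast
  then have "{..<m} \<subseteq> cl (insert e (S - {f}))"
    using cl_hull[OF _ sub] S by blast
  then show thesis using that f R \<open>prec k e f\<close> by blast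
qed

text \<open>Each exchange replaces an element of \<open>S\<close> by one of smaller rank and no
  larger cost, so the sum of ranks drops until \<open>S\<close> contains the greedy set. A general
  monotone \<open>c\<close> covers both the keys themselves and the constant 1, which counts
  elements.\<close>

lemma greedy_le:
  fixes c :: "nat \<Rightarrow> real"
  assumes mono: "\<And>i j. i < m \<Longrightarrow> j < m \<Longrightarrow> prec k i j \<Longrightarrow> c i \<le> c j"
    and nonneg: "\<And>i. i < m \<Longrightarrow> 0 \<le> c i"
    and "S \<subseteq> {..<m}" "{..<m} \<subseteq> cl S"
  shows "sum c (greedy k) \<le> sum c S"
  using assms(3,4)
proof (induction S rule: measure_induct_rule[where f = "sum (\<lambda>i. card (below k i))"])
  case (less S)
  have fin: "finite S" using less.prems finite_subset by blast
  show ?case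
  proof (cases "greedy k \<subseteq> S")
    case True
    then show ?thesis
      using fin nonneg less.prems by (intro sum_mono2) auto
  next
    case False
    then obtain e where e: "e \<in> greedy k" "e \<notin> S" by blast
    obtain f where f: "f \<in> S" "prec k e f" "{..<m} \<subseteq> cl (insert e (S - {f}))"
      using exchange_step[OF less.prems e] .
    let ?S = "insert e (S - {f})"
    have em: "e < m" and fm: "f < m" using e f less.prems greedy_subset by blast+
    have "sum (\<lambda>i. card (below k i)) ?S < sum (\<lambda>i. card (below k i)) S"
      using fin e f(1) card_below_less[OF f(2) em] by (simp add: sum.remove[of S f])
    then have "sum c (greedy k) \<le> sum c ?S"
      using less.IH[of ?S] less.prems f em by blast
    also have "\<dots> \<le> sum c S"
      using fin e f(1) mono[OF em fm f(2)] by (simp add: sum.remove[of S f c])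
    finally show ?thesis .
  qed
qed

lemma card_greedy: "card (greedy k) = card (greedy k')"
proof -
  have "real (card (greedy k)) \<le> real (card (greedy k'))" for k k'
    using greedy_le[of k "\<lambda>_. 1" "greedy k'"] greedy_subset greedy_spans by simp
  then show ?thesis by (meson le_antisym of_nat_le_iff)
qed

section \<open>Raising a single key\<close>

lemma below_raise:
  assumes "k f \<le> y" "i \<noteq> f"
  shows "below (k(f := y)) i \<subseteq> below k i"
  using assms by (auto simp: below_def prec_def split: if_splits)

text \<open>Raising \<open>f\<close> can only delete \<open>f\<close> from the predecessors of
  another element, which shrinks the closure that could reject that element.\<close>

lemma greedy_raise_subset:
  assumes "k f \<le> y"
  shows "greedy k - {f} \<subseteq> greedy (k(f := y))"
proof
  fix i assume i: "i \<in> greedy k - {f}"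
  then have "cl (below (k(f := y)) i) \<subseteq> cl (below k i)"
    using assms by (intro cl_mono below_raise below_subset) auto
  then show "i \<in> greedy (k(f := y))" using i by (auto simp: greedy_def)
qed

lemma greedy_raise_member:
  assumes "k f \<le> y" "f \<in> greedy (k(f := y))"
  shows "f \<in> greedy k"
proof -
  have "below k f \<subseteq> below (k(f := y)) f"
    using assms(1) by (auto simp: below_def prec_def)
  then have "cl (below k f) \<subseteq> cl (below (k(f := y)) f)"
    by (rule cl_mono[OF _ below_subset])
  then show ?thesis using assms(2) by (auto simp: greedy_def)
qed

text \<open>The other members survive and the cardinality stays the same, so the only possible
  change is a swap of \<open>f\<close> for a single \<open>g\<close>.\<close>

lemma greedy_raise:
  assumes le: "k f \<le> y"
  shows "greedy (k(f := y)) = greedy k \<or>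
    (\<exists>g < m. f \<in> greedy k \<and> f \<notin> greedy (k(f := y)) \<and> g \<notin> greedy k \<and> k g \<le> y \<and>
      greedy (k(f := y)) = insert g (greedy k - {f}))"
proof (cases "f \<in> greedy k \<and> f \<notin> greedy (k(f := y))")
  case False
  then have "greedy k \<subseteq> greedy (k(f := y))"
    using greedy_raise_subset[of k f y, OF le] by blast
  then show ?thesis
    using card_subset_eq[OF finite_greedy] card_greedy by metis
next
  case True
  let ?k = "k(f := y)"
  have sub: "greedy k - {f} \<subseteq> greedy ?k"
    by (rule greedy_raise_subset[of k f y, OF le])
  have "card (greedy ?k - (greedy k - {f})) = card (greedy ?k) - card (greedy k - {f})"
    using sub by (intro card_Diff_subset) auto
  also have "\<dots> = 1"
    using True card_greedy[of ?k k] card_gt_0_iff[of "greedy k"] by (auto simp: card_Diff_singleton)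
  finally obtain g where g: "greedy ?k - (greedy k - {f}) = {g}"
    by (rule card_1_singletonE)
  then have "greedy ?k = insert g (greedy k - {f})" using sub by blast
  moreover have gk: "g \<in> greedy ?k" "g \<noteq> f" "g \<notin> greedy k" using g True by blast+
  moreover have "g < m" using gk greedy_subset by blast
  \<comment> \<open>Were the key of \<open>g\<close> above both keys of \<open>f\<close>, the
    predecessors of \<open>g\<close> would be the same before and after, and so would its
    acceptance.\<close>
  moreover have "k g \<le> y"
  proof (rule ccontr)
    assume "\<not> k g \<le> y"
    then have "below k g = below ?k g"
      using le gk by (auto simp: below_def prec_def)
    then show False using gk by (simp add: greedy_def)
  qed
  ultimately show ?thesis using True by blast
qed

text \<open>With the other keys fixed, the values at which \<open>f\<close> is accepted are closed
  downwards, by \<open>greedy_raise_member\<close>.\<close>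

lemma greedy_threshold:
  assumes "f \<in> greedy (k(f := x))" "f \<notin> greedy (k(f := y))"
  shows "x \<le> y"
proof (rule ccontr)
  assume "\<not> x \<le> y"
  then show False
    using greedy_raise_member[of "k(f := y)" f x] assms by (simp only: fun_upd_upd fun_upd_same) simp
qed

end

section \<open>The graphic matroid\<close>

definition adj :: "(nat \<times> nat) list \<Rightarrow> nat set \<Rightarrow> (nat \<times> nat) set" where
  "adj es A = {(x, y). \<exists>j\<in>A. {x, y} = pair_edge (es ! j)}"

text \<open>The ground set consists of list positions, as the program sees the edges. Since
  \<open>adj\<close> is symmetric, the test of the stored pair \<open>es ! i\<close> does not depend
  on its orientation.\<close>

definition edge_span :: "(nat \<times> nat) list \<Rightarrow> nat set \<Rightarrow> nat set" where
  "edge_span es A = {i. i < length es \<and> es ! i \<in> (adj es A)\<^sup>*}"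

definition edges :: "(nat \<times> nat) list \<Rightarrow> nat set \<Rightarrow> nat set set" where
  "edges es A = (\<lambda>i. pair_edge (es ! i)) ` A"

lemma adj_edges: "adj es A = {(x, y). {x, y} \<in> edges es A}"
  by (auto simp: adj_def edges_def)

lemma adjI: "j \<in> A \<Longrightarrow> pair_edge (es ! j) = {x, y} \<Longrightarrow> (x, y) \<in> adj es A"
  by (auto simp: adj_def)

lemma adj_rtrancl_sym: "(x, y) \<in> (adj es A)\<^sup>* \<Longrightarrow> (y, x) \<in> (adj es A)\<^sup>*"
proof -
  have "sym (adj es A)" by (auto simp: adj_def sym_def insert_commute)
  then show "(x, y) \<in> (adj es A)\<^sup>* \<Longrightarrow> (y, x) \<in> (adj es A)\<^sup>*"
    using sym_rtrancl symD by metis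
qed

lemma in_adj_rtrancl_if_edge:
  assumes "{x, y} = pair_edge p"
  shows "(x, y) \<in> (adj es A)\<^sup>* \<longleftrightarrow> p \<in> (adj es A)\<^sup>*"
proof -
  have "p = (x, y) \<or> p = (y, x)"
    using assms by (cases p) (auto simp: pair_edge_def doubleton_eq_iff)
  then show ?thesis using adj_rtrancl_sym by auto
qed

lemma adj_subset_if_edge_span:
  assumes "A \<subseteq> edge_span es B"
  shows "(adj es A)\<^sup>* \<subseteq> (adj es B)\<^sup>*"
proof (rule rtrancl_subset_rtrancl, clarify)
  fix x y assume "(x, y) \<in> adj es A"
  then obtain j where "j \<in> A" "{x, y} = pair_edge (es ! j)" by (auto simp: adj_def)
  then show "(x, y) \<in> (adj es B)\<^sup>*"
    using assms in_adj_rtrancl_if_edge by (auto simp: edge_span_def)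
qed

lemma subset_edge_span: "A \<subseteq> {..<length es} \<Longrightarrow> A \<subseteq> edge_span es A"
  by (force simp: edge_span_def adj_def pair_edge_def)

lemma adj_mono: "A \<subseteq> B \<Longrightarrow> adj es A \<subseteq> adj es B"
  by (auto simp: adj_def)

text \<open>One crossing of the new edge is enough to record: a walk that crosses it back returns to
  the endpoint that \<open>x\<close> reaches without it.\<close>

lemma adj_insert_rtrancl:
  assumes "(x, y) \<in> (adj es (insert f A))\<^sup>*" "es ! f = (a, b)"
  shows "(x, y) \<in> (adj es A)\<^sup>* \<or> (x, a) \<in> (adj es A)\<^sup>* \<and> (b, y) \<in> (adj es A)\<^sup>* \<or>
    (x, b) \<in> (adj es A)\<^sup>* \<and> (a, y) \<in> (adj es A)\<^sup>*"
  using assms(1)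
proof (induction rule: rtrancl_induct)
  case base
  show ?case by simp
next
  case (step y z)
  then have "(y, z) \<in> adj es A \<or> y = a \<and> z = b \<or> y = b \<and> z = a"
    using assms(2) by (auto simp: adj_def pair_edge_def doubleton_eq_iff)
  then show ?case
    using step.IH by (auto intro: rtrancl_into_rtrancl adj_rtrancl_sym)
qed

interpretation graphic: closure_matroid "length es" "edge_span es" for es
proof
  show "A \<subseteq> {..<length es} \<Longrightarrow> A \<subseteq> edge_span es A" for A
    by (rule subset_edge_span)
  show "A \<subseteq> edge_span es B \<Longrightarrow> B \<subseteq> {..<length es} \<Longrightarrow> edge_span es A \<subseteq> edge_span es B" for A B
    using adj_subset_if_edge_span[of A es B] unfolding edge_span_def by blast
next
  fix i f A
  assume *: "i \<in> edge_span es (insert f A)" "i \<notin> edge_span es A" "insert f A \<subseteq> {..<length es}"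
    "i < length es"
  obtain a b x y where ab: "es ! f = (a, b)" and xy: "es ! i = (x, y)" by fastforce
  let ?R = "(adj es (insert i A))\<^sup>*"
  have mono: "(adj es A)\<^sup>* \<subseteq> ?R"
    by (rule rtrancl_mono) (auto intro!: adj_mono)
  have edge: "(x, y) \<in> ?R" "(y, x) \<in> ?R"
    using xy by (auto simp: adj_def pair_edge_def)
  \<comment> \<open>As \<open>A\<close> alone does not join \<open>x\<close> to \<open>y\<close>,
    the connection crosses the edge \<open>f\<close>; its two halves together with \<open>i\<close>
    then join the ends of \<open>f\<close>.\<close>
  have "(x, a) \<in> (adj es A)\<^sup>* \<and> (b, y) \<in> (adj es A)\<^sup>* \<or>
    (x, b) \<in> (adj es A)\<^sup>* \<and> (a, y) \<in> (adj es A)\<^sup>*"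
    using adj_insert_rtrancl[OF _ ab, of x y A] * xy by (auto simp: edge_span_def)
  then have "(a, x) \<in> ?R \<and> (y, b) \<in> ?R \<or> (a, y) \<in> ?R \<and> (x, b) \<in> ?R"
    using mono adj_rtrancl_sym by blast
  then have "(a, b) \<in> ?R"
    using edge by (meson rtrancl_trans)
  then show "f \<in> edge_span es (insert i A)"
    using * ab by (auto simp: edge_span_def)
qed

abbreviation greedy_tree :: "(nat \<times> nat) list \<Rightarrow> (nat \<Rightarrow> real) \<Rightarrow> nat set" where
  "greedy_tree es \<equiv> closure_matroid.greedy (length es) (edge_span es)"

text \<open>Coinciding edges would make \<open>a\<close> and \<open>b\<close> successors of each
  other, forcing a cycle of length 2; hence the bound 3.\<close>

lemma cycle_edges_distinct:
  assumes "distinct vs" "3 \<le> length vs" "a < length vs" "b < length vs" "a \<noteq> b"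
  shows "{vs ! a, vs ! (Suc a mod length vs)} \<noteq> {vs ! b, vs ! (Suc b mod length vs)}"
proof
  let ?L = "length vs"
  assume eq: "{vs ! a, vs ! (Suc a mod ?L)} = {vs ! b, vs ! (Suc b mod ?L)}"
  have lt: "Suc a mod ?L < ?L" "Suc b mod ?L < ?L"
    using assms by (auto intro!: mod_less_divisor)
  have "a = Suc b mod ?L" "b = Suc a mod ?L"
    using eq assms lt by (auto simp: doubleton_eq_iff nth_eq_iff_index_eq)
  moreover have "Suc c mod ?L = (if Suc c = ?L then 0 else Suc c)" if "c < ?L" for c
    using that by simp
  ultimately show False using assms by (auto split: if_splits)
qed

text \<open>All edges of a cycle other than the one latest in the greedy order precede that edge and
  join its endpoints, so it would have been rejected.\<close>

lemma greedy_tree_acyclic: "\<not> graph_cycle (edges es (greedy_tree es k)) vs"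
proof
  let ?T = "greedy_tree es k" and ?L = "length vs"
  assume cyc: "graph_cycle (edges es ?T) vs"
  then have L: "3 \<le> ?L" and dist: "distinct vs" by (auto simp: graph_cycle_def)
  have "\<forall>l. \<exists>i. l < ?L \<longrightarrow> i \<in> ?T \<and> pair_edge (es ! i) = {vs ! l, vs ! (Suc l mod ?L)}"
    using cyc by (fastforce simp: graph_cycle_def edges_def)
  then obtain idx where idx: "\<And>l. l < ?L \<Longrightarrow> idx l \<in> ?T"
    "\<And>l. l < ?L \<Longrightarrow> pair_edge (es ! idx l) = {vs ! l, vs ! (Suc l mod ?L)}"
    by metis
  let ?c = "\<lambda>l. card (closure_matroid.below (length es) k (idx l))"
  have "finite (?c ` {..<?L})" "?c ` {..<?L} \<noteq> {}" using L by (auto simp: lessThan_empty_iff)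
  from Max_in[OF this] obtain l0 where l0: "l0 < ?L" "?c l0 = Max (?c ` {..<?L})" by auto
  have max: "?c l \<le> ?c l0" if "l < ?L" for l
    using that by (auto simp: l0(2))
  let ?B = "closure_matroid.below (length es) k (idx l0)"
  have len: "idx l < length es" if "l < ?L" for l
    using idx(1)[OF that] graphic.greedy_subset by blast
  have below: "idx l \<in> ?B" if "l < ?L" "l \<noteq> l0" for l
  proof -
    have "idx l \<noteq> idx l0"
      using idx(2) l0 that cycle_edges_distinct[OF dist L that(1) l0(1) that(2)] by metis
    moreover have "\<not> prec k (idx l0) (idx l)"
      using graphic.card_below_less len[OF l0(1)] max[OF that(1)] by (meson leD)
    ultimately show ?thesis
      using prec_linear len[OF that(1)] by (auto simp: graphic.below_def)
  qed
  \<comment> \<open>Walk round the cycle from the far end of edge \<open>l0\<close>; at most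
    \<open>?L - 1\<close> steps never traverse \<open>l0\<close> itself.\<close>
  have path: "t < ?L \<Longrightarrow> (vs ! (Suc l0 mod ?L), vs ! ((Suc l0 + t) mod ?L)) \<in> (adj es ?B)\<^sup>*" for t
  proof (induction t)
    case 0
    show ?case by simp
  next
    case (Suc t)
    let ?l = "(Suc l0 + t) mod ?L"
    have "?l \<noteq> l0"
    proof (cases "Suc l0 + t < ?L")
      case False
      then have "?l = Suc l0 + t - ?L"
        using l0 Suc.prems by (simp add: le_mod_geq)
      then show ?thesis using False Suc.prems by linarith
    qed simp
    moreover have "?l < ?L" using L by (intro mod_less_divisor) linarith
    moreover have "Suc ?l mod ?L = (Suc l0 + Suc t) mod ?L" by (simp add: mod_Suc_eq)
    ultimately have "(vs ! ?l, vs ! ((Suc l0 + Suc t) mod ?L)) \<in> adj es ?B"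
      using adjI[OF below idx(2), of ?l] by metis
    then show ?case
      using rtrancl_into_rtrancl[OF Suc.IH[OF Suc_lessD[OF Suc.prems]]] by blast
  qed
  have "Suc l0 + (?L - 1) = l0 + ?L" using L by linarith
  then have "(Suc l0 + (?L - 1)) mod ?L = l0" using l0(1) by simp
  then have "(vs ! (Suc l0 mod ?L), vs ! l0) \<in> (adj es ?B)\<^sup>*"
    using path[of "?L - 1"] L by simp
  then have "es ! idx l0 \<in> (adj es ?B)\<^sup>*"
    using in_adj_rtrancl_if_edge idx(2)[OF l0(1)] by (metis insert_commute)
  then show False
    using idx(1)[OF l0(1)] len[OF l0(1)] by (auto simp: graphic.greedy_def edge_span_def)
qed

section \<open>Comparison with an optimal spanning tree\<close>

lemma edges_all:
  assumes "input_graph n E es"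
  shows "edges es {..<length es} = E"
proof -
  have "pair_edge ` set es = E" using assms by (simp add: input_graph_def)
  moreover have "set es = (!) es ` {..<length es}" by (auto simp: set_conv_nth)
  ultimately show ?thesis by (auto simp: edges_def)
qed

lemma inj_on_pair_edge:
  assumes "input_graph n E es"
  shows "inj_on (\<lambda>i. pair_edge (es ! i)) {..<length es}"
proof -
  have "distinct (map pair_edge es)" using assms by (simp add: input_graph_def)
  then show ?thesis by (auto simp: inj_on_def distinct_conv_nth)
qed

lemma greedy_tree_spanning_tree:
  assumes "input_graph n E es"
  shows "spanning_tree {..<n} E (edges es (greedy_tree es k))"
proof -
  have "edges es (greedy_tree es k) \<subseteq> E"
    using edges_all[OF assms] graphic.greedy_subset by (fastforce simp: edges_def)
  moreover have "graph_connected {..<n} (edges es (greedy_tree es k))"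
  proof -
    have "(adj es {..<length es})\<^sup>* \<subseteq> (adj es (greedy_tree es k))\<^sup>*"
      by (rule adj_subset_if_edge_span[OF graphic.greedy_spans])
    moreover have "graph_connected {..<n} E" using assms by (simp add: input_graph_def)
    ultimately show ?thesis
      unfolding graph_connected_def adj_edges edges_all[OF assms] by blast
  qed
  ultimately show ?thesis
    using greedy_tree_acyclic by (auto simp: spanning_tree_def)
qed

text \<open>Turns a competing tree into a spanning set of positions, the form that
  \<open>graphic.greedy_le\<close> takes.\<close>

lemma spanning_tree_span:
  assumes "input_graph n E es" "spanning_tree {..<n} E T"
  obtains S where "S \<subseteq> {..<length es}" "edges es S = T" "{..<length es} \<subseteq> edge_span es S"
proof
  let ?S = "{i. i < length es \<and> pair_edge (es ! i) \<in> T}"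
  show "?S \<subseteq> {..<length es}" by auto
  show edges: "edges es ?S = T"
    using assms(2) edges_all[OF assms(1)] by (auto simp: edges_def spanning_tree_def)
  show "{..<length es} \<subseteq> edge_span es ?S"
  proof
    fix i assume "i \<in> {..<length es}"
    then have i: "i < length es" by simp
    then have "pair_edge (es ! i) \<in> E" using edges_all[OF assms(1)] by (auto simp: edges_def)
    then obtain u v where "pair_edge (es ! i) = {u, v}" "u \<in> {..<n}" "v \<in> {..<n}"
      using assms(1) unfolding input_graph_def simple_graph_def by blast
    moreover have "fst (es ! i) \<in> pair_edge (es ! i)" "snd (es ! i) \<in> pair_edge (es ! i)"
      by (auto simp: pair_edge_def)
    ultimately have "fst (es ! i) \<in> {..<n}" "snd (es ! i) \<in> {..<n}" by auto
    then have "(fst (es ! i), snd (es ! i)) \<in> (adj es ?S)\<^sup>*"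
      using assms(2) unfolding adj_edges edges spanning_tree_def graph_connected_def by blast
    then show "i \<in> edge_span es ?S" using i by (simp add: edge_span_def)
  qed
qed

lemma sum_edges:
  assumes "input_graph n E es" "A \<subseteq> {..<length es}"
  shows "sum w (edges es A) = (\<Sum>i\<in>A. w (pair_edge (es ! i)))"
  unfolding edges_def
  using sum.reindex[OF inj_on_subset[OF inj_on_pair_edge[OF assms(1)] assms(2)]] by (simp add: comp_def)

text \<open>Greedy minimises the total key, and keys lie between the weights and
  \<open>1 + q\<close> times the weights, so w(T) <= k(T) <= k(S) <= (1 + q) w(S) for every
  competitor \<open>S\<close>.\<close>

lemma greedy_tree_approx:
  assumes G: "input_graph n E es" and q: "0 \<le> q"
    and w: "\<And>i. i < length es \<Longrightarrow> 0 \<le> w (pair_edge (es ! i))"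
    and k: "\<And>i. i < length es \<Longrightarrow> w (pair_edge (es ! i)) \<le> k i"
      "\<And>i. i < length es \<Longrightarrow> k i \<le> (1 + q) * w (pair_edge (es ! i))"
  shows "sum w (edges es (greedy_tree es k)) \<le> (1 + q) * mst_opt {..<n} E w"
proof -
  let ?w = "\<lambda>i. w (pair_edge (es ! i))" and ?T = "greedy_tree es k"
  have le: "sum w (edges es ?T) \<le> (1 + q) * sum w T" if T: "spanning_tree {..<n} E T" for T
  proof -
    obtain S where S: "S \<subseteq> {..<length es}" "edges es S = T" "{..<length es} \<subseteq> edge_span es S"
      using spanning_tree_span[OF G T] .
    have "sum w (edges es ?T) = sum ?w ?T"
      by (rule sum_edges[OF G graphic.greedy_subset])
    also have "\<dots> \<le> sum k ?T"
      using k(1) graphic.greedy_subset by (intro sum_mono) blast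
    also have "\<dots> \<le> sum k S"
    proof (rule graphic.greedy_le[OF _ _ S(1,3)])
      show "0 \<le> k i" if "i < length es" for i using w k(1) that by (meson order_trans)
    qed (auto simp: prec_def)
    also have "\<dots> \<le> (\<Sum>i\<in>S. (1 + q) * ?w i)"
      using k(2) S(1) by (intro sum_mono) blast
    also have "\<dots> = (1 + q) * sum w T"
      using sum_edges[OF G S(1), of w] S(2) by (simp add: sum_distrib_left)
    finally show ?thesis .
  qed
  let ?X = "{T. spanning_tree {..<n} E T}"
  have "finite E" using edges_all[OF G] by (auto simp: edges_def)
  then have "finite ?X"
    using finite_subset[of ?X "Pow E"] by (auto simp: spanning_tree_def)
  moreover have "?X \<noteq> {}" using greedy_tree_spanning_tree[OF G] by blast
  ultimately have "mst_opt {..<n} E w \<in> sum w ` ?X"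
    unfolding mst_opt_def by (intro Min_in) auto
  then show ?thesis using le by auto
qed

section \<open>The program\<close>

text \<open>A total-correctness judgement with a step budget. The budget is only an upper bound, so
  that branches of different cost can share it.\<close>

definition runs :: "(nat \<Rightarrow> real) \<Rightarrow> com \<Rightarrow> state \<Rightarrow> nat \<Rightarrow> (state \<Rightarrow> bool) \<Rightarrow> bool" where
  "runs \<omega> c s B Q \<longleftrightarrow> (\<exists>t s'. exec \<omega> c s t s' \<and> t \<le> B \<and> Q s')"

lemma runs_mono: "runs \<omega> c s B Q \<Longrightarrow> B \<le> B' \<Longrightarrow> (\<And>s'. Q s' \<Longrightarrow> Q' s') \<Longrightarrow> runs \<omega> c s B' Q'"
  unfolding runs_def by (meson order_trans)

lemma runs_Skip: "Q s \<Longrightarrow> runs \<omega> Skip s 1 Q"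
  unfolding runs_def using exec.Skip by blast

lemma runs_NAssign:
  "Q (s\<lparr>nmem := set_cell (nmem s) a (nval i s) (nval x s)\<rparr>) \<Longrightarrow> runs \<omega> (NAssign a i x) s 1 Q"
  unfolding runs_def using exec.NAssign by blast

lemma runs_RAssign:
  "Q (s\<lparr>rmem := set_cell (rmem s) a (nval i s) (rval x s)\<rparr>) \<Longrightarrow> runs \<omega> (RAssign a i x) s 1 Q"
  unfolding runs_def using exec.RAssign by blast

lemma runs_RSample:
  "Q (s\<lparr>rmem := set_cell (rmem s) a (nval i s) (\<omega> (tpos s)), tpos := Suc (tpos s)\<rparr>) \<Longrightarrow>
   runs \<omega> (RSample a i) s 1 Q"
  unfolding runs_def using exec.RSample by blast

lemma runs_Seq: "runs \<omega> c s B (\<lambda>s'. runs \<omega> d s' B' Q) \<Longrightarrow> runs \<omega> (Seq c d) s (B + B') Q"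
  unfolding runs_def using exec.Seq by (meson add_mono)

lemma runs_Cond:
  assumes "bval b s \<Longrightarrow> runs \<omega> c s B Q" "\<not> bval b s \<Longrightarrow> runs \<omega> d s B Q"
  shows "runs \<omega> (Cond b c d) s (Suc B) Q"
  using assms unfolding runs_def by (meson Suc_le_mono exec.CondT exec.CondF)

abbreviation cell0 :: "nat \<Rightarrow> nexp" where
  "cell0 a \<equiv> NCell a (NConst 0)"

definition for_loop :: "nat \<Rightarrow> nexp \<Rightarrow> com \<Rightarrow> com" where
  "for_loop a b c = Seq (NAssign a (NConst 0) (NConst 0))
     (While (NLess (cell0 a) b) (Seq c (NAssign a (NConst 0) (NAdd (cell0 a) (NConst 1)))))"

abbreviation set_counter :: "nat \<Rightarrow> nat \<Rightarrow> state \<Rightarrow> state" where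
  "set_counter a k s \<equiv> s\<lparr>nmem := set_cell (nmem s) a 0 k\<rparr>"

text \<open>The two extra steps per iteration pay for the test and the counter increment, the final
  2 for the initialisation and the failing test. The body must re-establish \<open>I\<close> for the
  state in which the counter is already advanced.\<close>

lemma runs_for_loop:
  assumes init: "I 0 (set_counter a 0 s)"
    and bound: "\<And>k s. I k s \<Longrightarrow> nval b s = N"
    and body: "\<And>k s. k < N \<Longrightarrow> I k s \<Longrightarrow> nmem s a 0 = k \<Longrightarrow>
      runs \<omega> c s B (\<lambda>s'. nmem s' a 0 = k \<and> I (Suc k) (set_counter a (Suc k) s'))"
  shows "runs \<omega> (for_loop a b c) s (N * (B + 2) + 2) (I N)"
proof -
  let ?W = "While (NLess (cell0 a) b) (Seq c (NAssign a (NConst 0) (NAdd (cell0 a) (NConst 1))))"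
  have loop: "d \<le> N \<Longrightarrow> I (N - d) s \<Longrightarrow> nmem s a 0 = N - d \<Longrightarrow>
      runs \<omega> ?W s (d * (B + 2) + 1) (I N)" for d s
  proof (induction d arbitrary: s)
    case 0
    then have "\<not> bval (NLess (cell0 a) b) s" using bound[of N s] by simp
    from exec.WhileF[OF this] show ?case
      using 0 by (auto simp: runs_def)
  next
    case (Suc d)
    let ?k = "N - Suc d"
    have k: "?k < N" "Suc ?k = N - d" using Suc.prems by auto
    obtain t s' where s': "exec \<omega> c s t s'" "t \<le> B" "nmem s' a 0 = ?k"
      "I (Suc ?k) (set_counter a (Suc ?k) s')"
      using body[OF k(1) Suc.prems(2,3)] by (auto simp: runs_def)
    let ?s = "set_counter a (Suc ?k) s'"
    have "exec \<omega> (NAssign a (NConst 0) (NAdd (cell0 a) (NConst 1))) s' 1 ?s"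
      using exec.NAssign[of \<omega> a "NConst 0" "NAdd (cell0 a) (NConst 1)" s'] s'(3) by simp
    from exec.Seq[OF s'(1) this]
    have step: "exec \<omega> (Seq c (NAssign a (NConst 0) (NAdd (cell0 a) (NConst 1)))) s (t + 1) ?s" .
    have "runs \<omega> ?W ?s (d * (B + 2) + 1) (I N)"
      using s'(4) Suc.prems(1) k(2) by (intro Suc.IH) (auto simp: set_cell_def)
    then obtain u s'' where u: "exec \<omega> ?W ?s u s''" "u \<le> d * (B + 2) + 1" "I N s''"
      by (auto simp: runs_def)
    have "bval (NLess (cell0 a) b) s"
      using Suc.prems bound[OF Suc.prems(2)] k(1) by simp
    from exec.WhileT[OF this step u(1)] show ?case
      using u s'(2) unfolding runs_def by (intro exI conjI) auto
  qed
  have "runs \<omega> ?W (set_counter a 0 s) (N * (B + 2) + 1) (I N)"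
    using loop[of N "set_counter a 0 s"] init by (simp add: set_cell_def)
  then have "runs \<omega> (for_loop a b c) s (1 + (N * (B + 2) + 1)) (I N)"
    unfolding for_loop_def
    by (intro runs_Seq runs_NAssign) simp
  then show ?thesis by (rule runs_mono) auto
qed

text \<open>Memory layout: the keys are stored in the real array 1; the natural arrays 5, 6 and 7 hold
  loop counters. A vertex counts as marked in iteration \<open>i\<close> of the outer loop iff its entry
  in array 4 exceeds \<open>i\<close>, so that the marks need no resetting between iterations.\<close>

abbreviation num_edges :: nexp where
  "num_edges \<equiv> NCell 0 (NConst 1)"

definition key_loop :: "rat \<Rightarrow> com" where
  "key_loop q = for_loop 5 num_edges (Seq (RSample 1 (cell0 5))
     (RAssign 1 (cell0 5) (RMul (RCell 0 (cell0 5))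
       (RAdd (RConst 1) (RMul (RConst q) (RCell 1 (cell0 5)))))))"

text \<open>With only negation, conjunction and strict comparison at hand, the disjunction is
  written by De Morgan and a tie of keys as absence of the reverse comparison.\<close>

definition prec_test :: "nexp \<Rightarrow> nexp \<Rightarrow> bexp" where
  "prec_test j i = BNot (BAnd (BNot (RLess (RCell 1 j) (RCell 1 i)))
     (BNot (BAnd (BNot (RLess (RCell 1 i) (RCell 1 j))) (NLess j i))))"

definition mark_test :: "nexp \<Rightarrow> bexp" where
  "mark_test v = NLess (cell0 5) (NCell 4 v)"

definition mark :: "nexp \<Rightarrow> com" where
  "mark v = NAssign 4 v (NAdd (cell0 5) (NConst 1))"

definition relax :: com where
  "relax = Cond (prec_test (cell0 7) (cell0 5))
     (Seq (Cond (mark_test (NCell 1 (cell0 7))) (mark (NCell 2 (cell0 7))) Skip)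
          (Cond (mark_test (NCell 2 (cell0 7))) (mark (NCell 1 (cell0 7))) Skip))
     Skip"

text \<open>Bellman-Ford style flooding from the first endpoint of edge \<open>i\<close> along its
  predecessors. Each edge gives two ordered adjacent pairs, so twice the number of edges bounds the
  rounds required.\<close>

definition reach_loop :: com where
  "reach_loop = Seq (mark (NCell 1 (cell0 5)))
     (for_loop 6 (NAdd num_edges num_edges) (for_loop 7 num_edges relax))"

text \<open>Each edge gets its own search. Testing against all predecessors, as in
  \<open>greedy\<close>, avoids sorting the edges.\<close>

definition tree_loop :: com where
  "tree_loop = for_loop 5 num_edges (Seq reach_loop
     (Cond (mark_test (NCell 2 (cell0 5))) Skip (NAssign 3 (cell0 5) (NConst 1))))"

definition mst_program :: "rat \<Rightarrow> com" where
  "mst_program q = Seq (key_loop q) tree_loop"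

section \<open>Program states that hold the graph and the keys\<close>

lemma set_cell_apply [simp]: "set_cell m a i x b = (if b = a then (m a)(i := x) else m b)"
  by (simp add: set_cell_def)

definition graph_loaded :: "(nat \<times> nat) list \<Rightarrow> (nat \<Rightarrow> nat \<Rightarrow> nat) \<Rightarrow> bool" where
  "graph_loaded es M \<longleftrightarrow> M 0 1 = length es \<and>
     (\<forall>i < length es. M 1 i = fst (es ! i) \<and> M 2 i = snd (es ! i))"

definition loaded :: "(nat \<times> nat) list \<Rightarrow> (nat \<Rightarrow> real) \<Rightarrow> state \<Rightarrow> bool" where
  "loaded es k s \<longleftrightarrow> graph_loaded es (nmem s) \<and> (\<forall>i < length es. rmem s 1 i = k i)"

lemma graph_loaded_update [simp]:
  "a \<ge> 3 \<Longrightarrow> graph_loaded es (set_cell M a i x) \<longleftrightarrow> graph_loaded es M"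
  by (auto simp: graph_loaded_def)

lemma loaded_update [simp]:
  "a \<ge> 3 \<Longrightarrow> loaded es k (s\<lparr>nmem := set_cell (nmem s) a i x\<rparr>) \<longleftrightarrow> loaded es k s"
  by (simp add: loaded_def)

lemma loaded_num_edges: "loaded es k s \<Longrightarrow> nval num_edges s = length es"
  by (simp add: graph_loaded_def loaded_def)

lemma loaded_endpoints:
  "loaded es k s \<Longrightarrow> i < length es \<Longrightarrow> nmem s 1 i = fst (es ! i)"
  "loaded es k s \<Longrightarrow> i < length es \<Longrightarrow> nmem s 2 i = snd (es ! i)"
  by (auto simp: graph_loaded_def loaded_def)

lemma bval_prec_test:
  "bval (prec_test j i) s \<longleftrightarrow> prec (rmem s 1) (nval j s) (nval i s)"
  by (auto simp: prec_test_def prec_def)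

lemma runs_key_loop:
  "runs \<omega> (key_loop q) (init_state n es w) (length es * 4 + 2) (\<lambda>s.
     loaded es (\<lambda>i. w (pair_edge (es ! i)) * (1 + of_rat q * \<omega> i)) s \<and>
     nmem s 3 = (\<lambda>_. 0) \<and> nmem s 4 = (\<lambda>_. 0))"
proof -
  let ?k = "\<lambda>i. w (pair_edge (es ! i)) * (1 + of_rat q * \<omega> i)"
  \<comment> \<open>\<open>tpos s = j\<close> ties sample number \<open>j\<close> to edge
    \<open>j\<close>, which makes each key an explicit function of the tape.\<close>
  define I where "I j s \<longleftrightarrow> graph_loaded es (nmem s) \<and> tpos s = j \<and>
    (\<forall>i < length es. rmem s 0 i = w (pair_edge (es ! i))) \<and> (\<forall>i < j. rmem s 1 i = ?k i) \<and>
    nmem s 3 = (\<lambda>_. 0) \<and> nmem s 4 = (\<lambda>_. 0)" for j and s :: state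
  have "runs \<omega> (key_loop q) (init_state n es w) (length es * ((1 + 1) + 2) + 2) (I (length es))"
    unfolding key_loop_def
  proof (rule runs_for_loop)
    show "I 0 (set_counter 5 0 (init_state n es w))"
      by (auto simp: I_def init_state_def graph_loaded_def)
    show "nval num_edges s = length es" if "I k s" for k s
      using that by (simp add: I_def graph_loaded_def)
    fix j s
    assume j: "j < length es" and I: "I j s" and c: "nmem s 5 0 = j"
    show "runs \<omega> (Seq (RSample 1 (cell0 5))
        (RAssign 1 (cell0 5) (RMul (RCell 0 (cell0 5))
          (RAdd (RConst 1) (RMul (RConst q) (RCell 1 (cell0 5))))))) s (1 + 1)
      (\<lambda>s'. nmem s' 5 0 = j \<and> I (Suc j) (set_counter 5 (Suc j) s'))"
      by (intro runs_Seq runs_RSample runs_RAssign)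
        (use j I c in \<open>auto simp: I_def less_Suc_eq\<close>)
  qed
  then show ?thesis
    by (rule runs_mono) (auto simp: I_def loaded_def)
qed


section \<open>Search along the preceding edges\<close>

definition marked :: "nat \<Rightarrow> state \<Rightarrow> nat set" where
  "marked i s = {v. i < nmem s 4 v}"

abbreviation edges_below :: "(nat \<times> nat) list \<Rightarrow> (nat \<Rightarrow> real) \<Rightarrow> nat \<Rightarrow> nat set" where
  "edges_below es \<equiv> closure_matroid.below (length es)"

text \<open>The soundness half of the search: only reachable vertices are marked. The bound
  \<open>Suc i\<close> on array 4 ensures that no vertex counts as marked when iteration
  \<open>Suc i\<close> begins.\<close>

definition marking :: "(nat \<times> nat) list \<Rightarrow> (nat \<Rightarrow> real) \<Rightarrow> (nat \<Rightarrow> nat) \<Rightarrow> nat \<Rightarrow> state \<Rightarrow> bool" where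
  "marking es k out i s \<longleftrightarrow> loaded es k s \<and> nmem s 3 = out \<and> nmem s 5 0 = i \<and>
     (\<forall>v. nmem s 4 v \<le> Suc i) \<and> marked i s \<subseteq> (adj es (edges_below es k i))\<^sup>* `` {fst (es ! i)}"

lemma marking_update [simp]:
  "a \<in> {6, 7} \<Longrightarrow> marking es k out i (s\<lparr>nmem := set_cell (nmem s) a j x\<rparr>) \<longleftrightarrow> marking es k out i s"
  by (auto simp: marking_def marked_def)

lemma marked_update [simp]:
  "a \<noteq> 4 \<Longrightarrow> marked i (s\<lparr>nmem := set_cell (nmem s) a j x\<rparr>) = marked i s"
  "marked i (s\<lparr>nmem := set_cell (nmem s) 4 v (Suc i)\<rparr>) = insert v (marked i s)"
  by (auto simp: marked_def)

lemma marking_mark: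
  assumes "marking es k out i s" "v \<in> marked i s" "(v, v') \<in> adj es (edges_below es k i)"
  shows "marking es k out i (s\<lparr>nmem := set_cell (nmem s) 4 v' (Suc i)\<rparr>)"
proof -
  have "v' \<in> (adj es (edges_below es k i))\<^sup>* `` {fst (es ! i)}"
    using assms unfolding marking_def by (blast intro: rtrancl_into_rtrancl)
  then show ?thesis using assms(1) by (simp add: marking_def)
qed

text \<open>Completeness is stated for the single edge \<open>j\<close>, so that the inner loop can
  accumulate it over all edges, and only for vertices marked at the start.\<close>

lemma runs_relax:
  assumes s: "marking es k out i s" "i < length es" "nmem s 7 0 = j" "j < length es" "nmem s 6 0 = r"
  shows "runs \<omega> relax s 5 (\<lambda>s'. marking es k out i s' \<and> nmem s' 7 0 = j \<and> nmem s' 6 0 = r \<and>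
    marked i s \<subseteq> marked i s' \<and>
    (\<forall>x y. x \<in> marked i s \<longrightarrow> (x, y) \<in> adj es (edges_below es k i \<inter> {j}) \<longrightarrow> y \<in> marked i s'))"
proof -
  let ?Q = "\<lambda>s'. marking es k out i s' \<and> nmem s' 7 0 = j \<and> nmem s' 6 0 = r \<and>
    marked i s \<subseteq> marked i s' \<and>
    (\<forall>x y. x \<in> marked i s \<longrightarrow> (x, y) \<in> adj es (edges_below es k i \<inter> {j}) \<longrightarrow> y \<in> marked i s')"
  obtain a b where ab: "es ! j = (a, b)" by fastforce
  have val: "nval (NCell 1 (cell0 7)) s' = a" "nval (NCell 2 (cell0 7)) s' = b" "nval (cell0 5) s' = i"
    if "marking es k out i s'" "nmem s' 7 0 = j" for s'
    using that loaded_endpoints[of es k s' j] s(4) ab by (auto simp: marking_def)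
  have test: "bval (prec_test (cell0 7) (cell0 5)) s \<longleftrightarrow> j \<in> edges_below es k i"
    using s by (auto simp: bval_prec_test marking_def loaded_def graphic.below_def prec_def)
  have mark_test: "bval (mark_test (NCell 1 (cell0 7))) s' \<longleftrightarrow> a \<in> marked i s'"
    "bval (mark_test (NCell 2 (cell0 7))) s' \<longleftrightarrow> b \<in> marked i s'"
    if "marking es k out i s'" "nmem s' 7 0 = j" for s'
    using val[OF that] by (auto simp: mark_test_def marked_def)
  have mark: "runs \<omega> (mark (NCell 1 (cell0 7))) s' 1 (\<lambda>s''. s'' = s'\<lparr>nmem := set_cell (nmem s') 4 a (Suc i)\<rparr>)"
    "runs \<omega> (mark (NCell 2 (cell0 7))) s' 1 (\<lambda>s''. s'' = s'\<lparr>nmem := set_cell (nmem s') 4 b (Suc i)\<rparr>)"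
    if "marking es k out i s'" "nmem s' 7 0 = j" for s'
    unfolding mark_def by (rule runs_NAssign, use val[OF that] in simp)+
  \<comment> \<open>One step for the order test, then a test and an assignment or skip for each
    direction: five in all.\<close>
  have "runs \<omega> relax s (Suc (Suc 1 + Suc 1)) ?Q"
    unfolding relax_def
  proof (rule runs_Cond)
    assume "\<not> bval (prec_test (cell0 7) (cell0 5)) s"
    then have "edges_below es k i \<inter> {j} = {}" using test by simp
    then show "runs \<omega> Skip s (Suc 1 + Suc 1) ?Q"
      using s by (intro runs_mono[OF runs_Skip[where Q = ?Q]]) (auto simp: adj_def)
  next
    assume "bval (prec_test (cell0 7) (cell0 5)) s"
    then have j: "j \<in> edges_below es k i" using test by simp
    then have adj: "(a, b) \<in> adj es (edges_below es k i)" "(b, a) \<in> adj es (edges_below es k i)"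
      using ab by (auto simp: pair_edge_def intro!: adjI[of j])
    have adj_j: "(x, y) \<in> adj es (edges_below es k i \<inter> {j}) \<longleftrightarrow> {x, y} = {a, b}" for x y
      using j ab by (auto simp: adj_def pair_edge_def)
    let ?P = "\<lambda>s'. marking es k out i s' \<and> nmem s' 7 0 = j \<and> nmem s' 6 0 = r \<and>
      marked i s \<subseteq> marked i s' \<and> (a \<in> marked i s \<longrightarrow> b \<in> marked i s')"
    have second: "runs \<omega> (Cond (mark_test (NCell 2 (cell0 7))) (mark (NCell 1 (cell0 7))) Skip) s' (Suc 1) ?Q"
      if P: "?P s'" for s'
    proof (rule runs_Cond)
      have b: "bval (mark_test (NCell 2 (cell0 7))) s' \<longleftrightarrow> b \<in> marked i s'"
        using mark_test(2) P by blast
      show "runs \<omega> (mark (NCell 1 (cell0 7))) s' 1 ?Q" if "bval (mark_test (NCell 2 (cell0 7))) s'"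
      proof (rule runs_mono[OF mark(1)])
        show "marking es k out i s'" "nmem s' 7 0 = j" using P by blast+
        fix s'' assume "s'' = s'\<lparr>nmem := set_cell (nmem s') 4 a (Suc i)\<rparr>"
        moreover have "marking es k out i (s'\<lparr>nmem := set_cell (nmem s') 4 a (Suc i)\<rparr>)"
          using P that b by (intro marking_mark[OF _ _ adj(2)]) auto
        ultimately show "?Q s''"
          using P that b by (auto simp: adj_j doubleton_eq_iff)
      qed simp
      show "runs \<omega> Skip s' 1 ?Q" if "\<not> bval (mark_test (NCell 2 (cell0 7))) s'"
        using P that b by (intro runs_Skip) (auto simp: adj_j doubleton_eq_iff)
    qed
    have "runs \<omega> (Cond (mark_test (NCell 1 (cell0 7))) (mark (NCell 2 (cell0 7))) Skip) s (Suc 1) ?P"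
    proof (rule runs_Cond)
      have a: "bval (mark_test (NCell 1 (cell0 7))) s \<longleftrightarrow> a \<in> marked i s"
        using mark_test(1) s by blast
      show "runs \<omega> (mark (NCell 2 (cell0 7))) s 1 ?P" if "bval (mark_test (NCell 1 (cell0 7))) s"
      proof (rule runs_mono[OF mark(2)])
        show "marking es k out i s" "nmem s 7 0 = j" using s by blast+
        fix s'' assume "s'' = s\<lparr>nmem := set_cell (nmem s) 4 b (Suc i)\<rparr>"
        moreover have "marking es k out i (s\<lparr>nmem := set_cell (nmem s) 4 b (Suc i)\<rparr>)"
          using s that a by (intro marking_mark[OF _ _ adj(1)]) auto
        ultimately show "?P s''"
          using s that a by auto
      qed simp
      show "runs \<omega> Skip s 1 ?P" if "\<not> bval (mark_test (NCell 1 (cell0 7))) s"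
        using s that a by (intro runs_Skip) auto
    qed
    then show "runs \<omega> (Seq (Cond (mark_test (NCell 1 (cell0 7))) (mark (NCell 2 (cell0 7))) Skip)
        (Cond (mark_test (NCell 2 (cell0 7))) (mark (NCell 1 (cell0 7))) Skip)) s (Suc 1 + Suc 1) ?Q"
      by (intro runs_Seq runs_mono[OF _ order_refl second])
  qed
  then show ?thesis by (simp add: numeral_eq_Suc)
qed

definition layers :: "('a \<times> 'a) set \<Rightarrow> 'a \<Rightarrow> nat \<Rightarrow> 'a set" where
  "layers R u r = {v. \<exists>l \<le> r. (u, v) \<in> R ^^ l}"

lemma layers_0 [simp]: "layers R u 0 = {u}"
  by (auto simp: layers_def)

lemma layers_Suc: "layers R u (Suc r) \<subseteq> layers R u r \<union> R `` layers R u r"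
proof
  fix v assume "v \<in> layers R u (Suc r)"
  then obtain l where l: "l \<le> Suc r" "(u, v) \<in> R ^^ l" by (auto simp: layers_def)
  show "v \<in> layers R u r \<union> R `` layers R u r"
  proof (cases "l = Suc r")
    case True
    then show ?thesis using l by (auto simp: layers_def)
  next
    case False
    then show ?thesis using l by (auto simp: layers_def le_Suc_eq)
  qed
qed

text \<open>In a finite relation reachability takes no more steps than the relation has pairs, and
  every edge contributes at most two.\<close>

lemma layers_adj:
  assumes "A \<subseteq> {..<length es}" "r = length es + length es"
  shows "layers (adj es A) u r = (adj es A)\<^sup>* `` {u}"
proof -
  let ?X = "(!) es ` {..<length es} \<union> prod.swap ` (!) es ` {..<length es}"
  have sub: "adj es A \<subseteq> ?X"
  proof clarify
    fix x y assume "(x, y) \<in> adj es A" "(x, y) \<notin> prod.swap ` (!) es ` {..<length es}"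
    then obtain j where "j \<in> A" "{x, y} = pair_edge (es ! j)" by (auto simp: adj_def)
    then have j: "j < length es" "es ! j = (x, y) \<or> es ! j = (y, x)"
      using assms(1) by (cases "es ! j"; auto simp: pair_edge_def doubleton_eq_iff)+
    moreover have "es ! j \<noteq> (y, x)"
    proof
      assume "es ! j = (y, x)"
      then have "prod.swap (es ! j) = (x, y)" by simp
      then show False
        using j(1) \<open>(x, y) \<notin> prod.swap ` (!) es ` {..<length es}\<close> by (metis image_eqI lessThan_iff)
    qed
    ultimately show "(x, y) \<in> (!) es ` {..<length es}" by force
  qed
  have "card (adj es A) \<le> card ?X"
    by (rule card_mono[OF _ sub]) simp
  also have "\<dots> \<le> card ((!) es ` {..<length es}) + card (prod.swap ` (!) es ` {..<length es})"
    by (rule card_Un_le)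
  also have "\<dots> \<le> r"
    using card_image_le[of "{..<length es}" "(!) es"]
      card_image_le[of "(!) es ` {..<length es}" prod.swap] assms(2) by simp
  finally have card: "card (adj es A) \<le> r" .
  have "finite (adj es A)" using finite_subset[OF sub] by simp
  note eq = rtrancl_finite_eq_relpow[OF this]
  show ?thesis
  proof
    show "layers (adj es A) u r \<subseteq> (adj es A)\<^sup>* `` {u}"
      by (auto simp: layers_def intro: relpow_imp_rtrancl)
    show "(adj es A)\<^sup>* `` {u} \<subseteq> layers (adj es A) u r"
      unfolding eq layers_def using card order_trans by blast
  qed
qed

text \<open>Before outer round \<open>r\<close> the ball of radius \<open>r\<close> is marked
  (\<open>I\<close>); in the course of the round, so are its neighbours along the first
  \<open>j\<close> edges (\<open>J\<close>). Marks set within a round may run ahead of the ball,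
  which the soundness clause of \<open>marking\<close> permits.\<close>

lemma runs_reach_loop:
  fixes es k i
  defines "R \<equiv> adj es (edges_below es k i)"
  assumes s: "loaded es k s" "nmem s 3 = out" "nmem s 5 0 = i" "\<And>v. nmem s 4 v \<le> i"
    and i: "i < length es"
  shows "runs \<omega> reach_loop s (1 + ((length es + length es) * (length es * (5 + 2) + 2 + 2) + 2))
    (\<lambda>s'. marking es k out i s' \<and> marked i s' = R\<^sup>* `` {fst (es ! i)})"
proof -
  let ?m = "length es" and ?u = "fst (es ! i)"
  define L where "L = layers R ?u"
  define I where "I r s \<longleftrightarrow> marking es k out i s \<and> L r \<subseteq> marked i s" for r s
  define J where "J r j s \<longleftrightarrow> I r s \<and> nmem s 6 0 = r \<and>
    (\<forall>x y. x \<in> L r \<longrightarrow> (x, y) \<in> adj es (edges_below es k i \<inter> {..<j}) \<longrightarrow> y \<in> marked i s)" for r j s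
  have round: "runs \<omega> (for_loop 7 num_edges relax) s (?m * (5 + 2) + 2)
      (\<lambda>s'. nmem s' 6 0 = r \<and> I (Suc r) (set_counter 6 (Suc r) s'))"
    if "I r s" "nmem s 6 0 = r" for r s
  proof -
    have "runs \<omega> (for_loop 7 num_edges relax) s (?m * (5 + 2) + 2) (J r ?m)"
    proof (rule runs_for_loop)
      show "J r 0 (set_counter 7 0 s)"
        using that by (auto simp: I_def J_def adj_def)
      show "nval num_edges s = ?m" if "J r j s" for j s
        using that loaded_num_edges[of es k s] by (auto simp: I_def J_def marking_def)
      fix j s assume j: "j < ?m" "J r j s" "nmem s 7 0 = j"
      have "adj es (edges_below es k i \<inter> {..<Suc j}) =
          adj es (edges_below es k i \<inter> {..<j}) \<union> adj es (edges_below es k i \<inter> {j})"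
        by (auto simp: adj_def less_Suc_eq)
      then show "runs \<omega> relax s 5 (\<lambda>s'. nmem s' 7 0 = j \<and> J r (Suc j) (set_counter 7 (Suc j) s'))"
        using j by (intro runs_mono[OF runs_relax[of es k out i s j r]])
          (auto simp: I_def J_def i)
    qed
    then show ?thesis
    proof (rule runs_mono)
      fix s' assume J: "J r ?m s'"
      have "edges_below es k i \<inter> {..<?m} = edges_below es k i"
        using graphic.below_subset[of es k i] by blast
      then have "L (Suc r) \<subseteq> marked i s'"
        using J layers_Suc[of R ?u r] by (auto simp: I_def J_def L_def R_def)
      then show "nmem s' 6 0 = r \<and> I (Suc r) (set_counter 6 (Suc r) s')"
        using J by (auto simp: I_def J_def)
    qed simp
  qed
  have "runs \<omega> reach_loop s (1 + ((?m + ?m) * (?m * (5 + 2) + 2 + 2) + 2)) (I (?m + ?m))"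
    unfolding reach_loop_def mark_def
  proof (rule runs_Seq, rule runs_NAssign, rule runs_for_loop)
    define s' where "s' = s\<lparr>nmem := set_cell (nmem s) 4 (nval (NCell 1 (cell0 5)) s)
      (nval (NAdd (cell0 5) (NConst 1)) s)\<rparr>"
    have "nval (NCell 1 (cell0 5)) s = ?u" "nval (NAdd (cell0 5) (NConst 1)) s = Suc i"
      using s i loaded_endpoints[of es k s i] by auto
    moreover have "marked i s = {}" using s(4) by (auto simp: marked_def not_less)
    ultimately have "I 0 s'"
      using s by (auto simp: s'_def I_def L_def marking_def le_Suc_eq)
    then show "I 0 (set_counter 6 0 (s\<lparr>nmem := set_cell (nmem s) 4 (nval (NCell 1 (cell0 5)) s)
        (nval (NAdd (cell0 5) (NConst 1)) s)\<rparr>))"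
      unfolding s'_def[symmetric] by (simp add: I_def)
    show "nval (NAdd num_edges num_edges) s = ?m + ?m" if "I r s" for r s
      using that loaded_num_edges[of es k s] by (simp add: I_def marking_def)
  qed (use round in blast)
  then show ?thesis
  proof (rule runs_mono)
    fix s' assume "I (?m + ?m) s'"
    then show "marking es k out i s' \<and> marked i s' = R\<^sup>* `` {?u}"
      using layers_adj[OF graphic.below_subset[of es k i] refl, of ?u]
      by (auto simp: I_def L_def R_def marking_def)
  qed simp
qed

lemma runs_tree_loop:
  assumes s: "loaded es k s" "nmem s 3 = (\<lambda>_. 0)" "nmem s 4 = (\<lambda>_. 0)"
  defines "B \<equiv> 1 + ((length es + length es) * (length es * (5 + 2) + 2 + 2) + 2) + Suc 1"
  shows "runs \<omega> tree_loop s (length es * (B + 2) + 2)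
    (\<lambda>s'. \<forall>j < length es. nmem s' 3 j \<noteq> 0 \<longleftrightarrow> j \<in> greedy_tree es k)"
proof -
  define I where "I i s \<longleftrightarrow> loaded es k s \<and> (\<forall>v. nmem s 4 v \<le> i) \<and>
    (\<forall>j. nmem s 3 j \<noteq> 0 \<longleftrightarrow> j < i \<and> j \<in> greedy_tree es k)" for i s
  have "runs \<omega> tree_loop s (length es * (B + 2) + 2) (I (length es))"
    unfolding tree_loop_def
  proof (rule runs_for_loop)
    show "I 0 (set_counter 5 0 s)" using s by (auto simp: I_def)
    show "nval num_edges s = length es" if "I i s" for i s
      using that loaded_num_edges[of es k s] by (auto simp: I_def)
    fix i s assume i: "i < length es" "I i s" "nmem s 5 0 = i"
    let ?R = "adj es (edges_below es k i)"
    show "runs \<omega> (Seq reach_loop (Cond (mark_test (NCell 2 (cell0 5))) Skip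
        (NAssign 3 (cell0 5) (NConst 1)))) s B
      (\<lambda>s'. nmem s' 5 0 = i \<and> I (Suc i) (set_counter 5 (Suc i) s'))"
      unfolding B_def
    proof (intro runs_Seq, rule runs_mono[OF runs_reach_loop])
      show "loaded es k s" "nmem s 3 = nmem s 3" "nmem s 5 0 = i" "i < length es"
        "\<And>v. nmem s 4 v \<le> i" using i by (auto simp: I_def)
      fix s' assume "marking es k (nmem s 3) i s' \<and> marked i s' = ?R\<^sup>* `` {fst (es ! i)}"
      then have s': "loaded es k s'" "nmem s' 3 = nmem s 3" "nmem s' 5 0 = i"
        "\<And>v. nmem s' 4 v \<le> Suc i" "marked i s' = ?R\<^sup>* `` {fst (es ! i)}"
        by (auto simp: marking_def)
      have "bval (mark_test (NCell 2 (cell0 5))) s' \<longleftrightarrow> snd (es ! i) \<in> marked i s'"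
        using s'(3) loaded_endpoints(2)[OF s'(1) i(1)] by (simp add: mark_test_def marked_def)
      also have "\<dots> \<longleftrightarrow> i \<notin> greedy_tree es k"
        using i(1) by (simp add: s'(5) graphic.greedy_def edge_span_def)
      finally have test: "bval (mark_test (NCell 2 (cell0 5))) s' \<longleftrightarrow> i \<notin> greedy_tree es k" .
      show "runs \<omega> (Cond (mark_test (NCell 2 (cell0 5))) Skip (NAssign 3 (cell0 5) (NConst 1))) s' (Suc 1)
        (\<lambda>s'. nmem s' 5 0 = i \<and> I (Suc i) (set_counter 5 (Suc i) s'))"
        by (intro runs_Cond runs_Skip runs_NAssign)
          (use i s' in \<open>auto simp: I_def loaded_def less_Suc_eq test\<close>)
    qed simp
  qed
  then show ?thesis
    by (rule runs_mono) (auto simp: I_def)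
qed

section \<open>The whole program and its running time\<close>

definition keys :: "real \<Rightarrow> (nat \<Rightarrow> real) \<Rightarrow> (nat \<Rightarrow> real) \<Rightarrow> nat \<Rightarrow> real" where
  "keys q x \<omega> i = x i * (1 + q * \<omega> i)"

text \<open>Extension by zero keeps the vector nonnegative everywhere and makes any two such vectors
  agree outside the list, as \<open>nn_integral_wdist\<close> demands.\<close>

definition weights :: "(nat \<times> nat) list \<Rightarrow> (nat set \<Rightarrow> real) \<Rightarrow> nat \<Rightarrow> real" where
  "weights es w i = (if i < length es then w (pair_edge (es ! i)) else 0)"

text \<open>Cubic because each edge starts a search with twice as many rounds as edges, and each
  round relaxes every edge; the leading coefficient is 14, and 100 absorbs the rest.\<close>

lemma runs_mst_program:
  "runs \<omega> (mst_program q) (init_state n es w) (100 * (1 + length es) ^ 3) (\<lambda>s.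
     output_edges es s = edges es (greedy_tree es (keys (of_rat q) (weights es w) \<omega>)))"
  (is "runs _ _ _ ?B ?Q")
proof -
  let ?m = "length es" and ?k = "keys (of_rat q) (weights es w) \<omega>"
  have "runs \<omega> (mst_program q) (init_state n es w) ((?m * 4 + 2) +
      (?m * (1 + ((?m + ?m) * (?m * (5 + 2) + 2 + 2) + 2) + Suc 1 + 2) + 2)) ?Q"
    unfolding mst_program_def
  proof (intro runs_Seq, rule runs_mono[OF runs_key_loop order_refl], elim conjE)
    fix s assume "loaded es (\<lambda>i. w (pair_edge (es ! i)) * (1 + real_of_rat q * \<omega> i)) s"
      "nmem s 3 = (\<lambda>_. 0)" "nmem s 4 = (\<lambda>_. 0)"
    then have s: "loaded es ?k s" "nmem s 3 = (\<lambda>_. 0)" "nmem s 4 = (\<lambda>_. 0)"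
      by (simp_all add: loaded_def keys_def weights_def)
    show "runs \<omega> tree_loop s
      (?m * (1 + ((?m + ?m) * (?m * (5 + 2) + 2 + 2) + 2) + Suc 1 + 2) + 2) ?Q"
    proof (rule runs_mono[OF runs_tree_loop[OF s] order_refl])
      fix s' :: state
      assume "\<forall>j < ?m. nmem s' 3 j \<noteq> 0 \<longleftrightarrow> j \<in> greedy_tree es ?k"
      then have "greedy_tree es ?k = {i. i < ?m \<and> nmem s' 3 i \<noteq> 0}"
        using graphic.greedy_subset[of es ?k] by auto
      then show "?Q s'" by (auto simp: output_edges_def edges_def)
    qed
  qed
  then show ?thesis
    by (rule runs_mono) (auto simp: power3_eq_cube algebra_simps)
qed

lemma polynomial_time_mst_program: "polynomial_time (mst_program q)"
  unfolding polynomial_time_def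
proof (intro exI[of _ "[:100:] * [:1, 1:] ^ 3"] allI impI)
  fix n E es w \<omega>
  obtain t s where "exec \<omega> (mst_program q) (init_state n es w) t s" "t \<le> 100 * (1 + length es) ^ 3"
    using runs_mst_program[of \<omega> q n es w] unfolding runs_def by blast
  moreover have "100 * (1 + length es) ^ 3 \<le> poly ([:100:] * [:1, 1:] ^ 3) (n + length es)"
    by (auto simp: poly_power intro!: power_mono)
  ultimately show "\<exists>t s. exec \<omega> (mst_program q) (init_state n es w) t s \<and>
      t \<le> poly ([:100:] * [:1, 1:] ^ 3) (n + length es)"
    by (meson order_trans)
qed

section \<open>Sensitivity of the greedy basis to a single weight\<close>

lemma keys_upd_weight: "keys q (x(f := b)) \<omega> = (keys q x \<omega>)(f := b * (1 + q * \<omega> f))"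
  by (auto simp: keys_def)

lemma keys_upd_tape: "keys q x (\<omega> (f := u)) = (keys q x \<omega>)(f := x f * (1 + q * u))"
  by (auto simp: keys_def)

context closure_matroid
begin

definition wdist :: "(nat \<Rightarrow> real) \<Rightarrow> nat set \<Rightarrow> (nat \<Rightarrow> real) \<Rightarrow> nat set \<Rightarrow> real" where
  "wdist x I x' I' = (\<Sum>i<m. \<bar>x i * indicator I i - x' i * indicator I' i\<bar>)"

lemma wdist_nonneg [simp]: "0 \<le> wdist x I x' I'"
  by (simp add: wdist_def sum_nonneg)

lemma wdist_refl [simp]: "wdist x I x I = 0"
  by (simp add: wdist_def)

lemma wdist_commute: "wdist x I x' I' = wdist x' I' x I"
  by (simp add: wdist_def abs_minus_commute)

lemma wdist_triangle: "wdist x I x'' I'' \<le> wdist x I x' I' + wdist x' I' x'' I''"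
  unfolding wdist_def sum.distrib[symmetric] by (intro sum_mono) linarith

text \<open>If the tree stays, only coordinate \<open>f\<close> can contribute. After a swap the
  cost is \<open>x f + x g\<close>, where \<open>x g\<close> is at most its key and so at most
  \<open>2 * b\<close>, all factors being at most 2.\<close>

lemma wdist_raise:
  assumes x: "\<And>i. 0 \<le> x i" and q: "0 < q" "q \<le> 1" and f: "f < m" "x f \<le> b"
    and \<omega>: "\<And>i. 0 \<le> \<omega> i" "\<And>i. \<omega> i \<le> 1"
  defines "T \<equiv> greedy (keys q x \<omega>)" and "T' \<equiv> greedy (keys q (x(f := b)) \<omega>)"
  shows "wdist x T (x(f := b)) T' \<le> (b - x f) + (if f \<in> T \<and> f \<notin> T' then 3 * b else 0)"
proof -
  let ?k = "keys q x \<omega>" and ?y = "b * (1 + q * \<omega> f)"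
  have b: "0 \<le> b" using x[of f] f by linarith
  have qw: "0 \<le> q * \<omega> i" "q * \<omega> i \<le> 1" for i
    using q \<omega>[of i] mult_le_one[of q "\<omega> i"] by auto
  have y: "?y \<le> 2 * b"
    using mult_left_mono[of "1 + q * \<omega> f" 2 b] qw[of f] b by simp
  have "?k f \<le> ?y"
    using f qw[of f] by (auto simp: keys_def intro!: mult_right_mono)
  note raise = greedy_raise[of ?k f ?y, OF this]
  have T': "T' = greedy (?k(f := ?y))" by (simp add: T'_def keys_upd_weight)
  consider "T' = T" | g where "g < m" "f \<in> T" "f \<notin> T'" "g \<notin> T" "?k g \<le> ?y" "T' = insert g (T - {f})"
    using raise by (auto simp: T_def T')
  then show ?thesis
  proof cases
    case 1
    have "wdist x T (x(f := b)) T' \<le> (\<Sum>i<m. if i = f then b - x f else 0)"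
      unfolding wdist_def 1 using f x[of f] by (intro sum_mono) (auto simp: indicator_def)
    then show ?thesis using 1 f by simp
  next
    case 2
    have "wdist x T (x(f := b)) T' \<le> (\<Sum>i<m. (if i = f then x f else 0) + (if i = g then x g else 0))"
      unfolding wdist_def using 2 x by (intro sum_mono) (auto simp: indicator_def)
    also have "\<dots> = x f + x g" using f 2(1) by (simp add: sum.distrib)
    also have "x g \<le> ?k g"
      using mult_left_mono[of 1 "1 + q * \<omega> g" "x g"] x[of g] qw[of g] by (simp add: keys_def)
    also have "\<dots> \<le> 2 * b" using 2 y by linarith
    finally show ?thesis using 2 f by simp
  qed
qed

text \<open>Comparing the accepting key at \<open>u\<close> with the rejecting key at
  \<open>v\<close> through \<open>greedy_threshold\<close> gives
  \<open>a * (1 + q * u) <= b * (1 + q * v)\<close>, so two switching samples differ by at most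
  \<open>2 * (b - a) / (a * q)\<close>.\<close>

lemma switching_interval:
  assumes a: "0 < a" "a \<le> b" and q: "0 < q" "q \<le> 1"
  obtains s where "\<And>u. 0 \<le> u \<Longrightarrow> u \<le> 1 \<Longrightarrow> f \<in> greedy (k(f := a * (1 + q * u))) \<Longrightarrow>
    f \<notin> greedy (k(f := b * (1 + q * u))) \<Longrightarrow> u \<in> {s..s + 2 * (b - a) / (a * q)}"
proof -
  let ?d = "2 * (b - a) / (a * q)"
  define S where "S = {u. 0 \<le> u \<and> u \<le> 1 \<and> f \<in> greedy (k(f := a * (1 + q * u))) \<and>
    f \<notin> greedy (k(f := b * (1 + q * u)))}"
  have diff: "u - ?d \<le> v" if "u \<in> S" "v \<in> S" for u v
  proof -
    have "a * (1 + q * u) \<le> b * (1 + q * v)"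
      using that greedy_threshold[of f k] by (auto simp: S_def)
    then have "a * q * (u - v) \<le> (b - a) * (1 + q * v)" by (simp add: algebra_simps)
    also have "\<dots> \<le> (b - a) * 2"
      using a q that mult_le_one[of q v] by (intro mult_left_mono) (auto simp: S_def)
    finally have "u - v \<le> ?d"
      using a q by (simp add: field_simps)
    then show ?thesis by linarith
  qed
  have bdd: "bdd_below S" by (rule bdd_belowI[of _ 0]) (auto simp: S_def)
  have "u \<in> {Inf S..Inf S + ?d}" if "u \<in> S" for u
  proof -
    have "Inf S \<le> u" using cInf_lower[OF that bdd] .
    moreover have "u - ?d \<le> Inf S"
      using that diff by (intro cInf_greatest) auto
    ultimately show ?thesis by simp
  qed
  \<comment> \<open>If no sample switches, \<open>Inf S\<close> is an unspecified value and the
    claim is vacuous.\<close>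
  then show thesis using that[of "Inf S"] by (auto simp: S_def)
qed

end

section \<open>Random tapes\<close>

abbreviation unit_uniform :: "real measure" where
  "unit_uniform \<equiv> uniform_measure lborel {0..1}"

lemma prob_space_unit_uniform: "prob_space unit_uniform"
  by (rule prob_space_uniform_measure) auto

lemma AE_unit_uniform: "AE u in unit_uniform. 0 \<le> u \<and> u \<le> 1"
  by (rule AE_uniform_measureI) auto

lemma emeasure_unit_uniform_le:
  assumes "0 \<le> d"
  shows "emeasure unit_uniform {s..s + d} \<le> ennreal d"
proof -
  have "emeasure unit_uniform {s..s + d} = emeasure lborel ({0..1} \<inter> {s..s + d})"
    by (subst emeasure_uniform_measure) (auto simp: divide_ennreal_def)
  also have "\<dots> \<le> emeasure lborel {s..s + d}" by (rule emeasure_mono) auto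
  also have "\<dots> = ennreal d" using assms by simp
  finally show ?thesis .
qed

lemma prob_space_random_tape: "prob_space random_tape"
  unfolding random_tape_def by (intro prob_space_PiM prob_space_unit_uniform)

lemma AE_random_tape: "AE \<omega> in random_tape. \<forall>i. 0 \<le> \<omega> i \<and> \<omega> i \<le> 1"
  unfolding AE_all_countable random_tape_def
  by (intro allI AE_PiM_component[where P = "\<lambda>u. 0 \<le> u \<and> u \<le> 1"] AE_unit_uniform prob_space_unit_uniform) auto

lemma space_random_tape [simp]: "space random_tape = UNIV"
  by (simp add: random_tape_def space_PiM)

lemma measurable_random_tape_component [measurable]: "(\<lambda>\<omega>. \<omega> i) \<in> borel_measurable random_tape"
proof -
  have "(\<lambda>\<omega>. \<omega> i) \<in> measurable random_tape unit_uniform"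
    unfolding random_tape_def by (rule measurable_component_singleton) simp
  moreover have "measurable random_tape unit_uniform = borel_measurable random_tape"
    by (rule measurable_cong_sets) simp_all
  ultimately show ?thesis by simp
qed

text \<open>Overwriting one coordinate by an independent fresh sample preserves the product measure.
  This allows averaging over the sample of \<open>f\<close> with all others frozen.\<close>

lemma nn_integral_random_tape_resample:
  assumes [measurable]: "h \<in> borel_measurable random_tape"
  shows "(\<integral>\<^sup>+ \<omega>. h \<omega> \<partial>random_tape) = (\<integral>\<^sup>+ \<omega>. \<integral>\<^sup>+ u. h (\<omega> (f := u)) \<partial>unit_uniform \<partial>random_tape)"
proof -
  let ?U = "\<lambda>_::nat. unit_uniform"
  interpret U: prob_space unit_uniform by (rule prob_space_unit_uniform)
  interpret R: prob_space random_tape by (rule prob_space_random_tape)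
  interpret pair_sigma_finite unit_uniform random_tape ..
  have upd: "(\<lambda>(u, \<omega>). \<omega> (f := u)) \<in> measurable (unit_uniform \<Otimes>\<^sub>M random_tape) random_tape"
    unfolding random_tape_def split_beta' by (rule measurable_fun_upd[where J = UNIV]) auto
  have "distr (unit_uniform \<Otimes>\<^sub>M random_tape) random_tape (\<lambda>(u, \<omega>). \<omega> (f := u)) = random_tape"
    using distr_pair_PiM_eq_PiM[of UNIV ?U f] prob_space_unit_uniform by (simp add: random_tape_def)
  then have "(\<integral>\<^sup>+ \<omega>. h \<omega> \<partial>random_tape) =
      (\<integral>\<^sup>+ \<omega>. h \<omega> \<partial>distr (unit_uniform \<Otimes>\<^sub>M random_tape) random_tape (\<lambda>(u, \<omega>). \<omega> (f := u)))"
    by simp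
  also have "\<dots> = (\<integral>\<^sup>+ p. h ((\<lambda>(u, \<omega>). \<omega> (f := u)) p) \<partial>(unit_uniform \<Otimes>\<^sub>M random_tape))"
    by (rule nn_integral_distr[OF upd]) simp
  also have "\<dots> = (\<integral>\<^sup>+ \<omega>. \<integral>\<^sup>+ u. h (\<omega> (f := u)) \<partial>unit_uniform \<partial>random_tape)"
    using nn_integral_snd[of "\<lambda>p. h ((\<lambda>(u, \<omega>). \<omega> (f := u)) p)"] measurable_compose[OF upd, of h borel]
    by simp
  finally show ?thesis .
qed

section \<open>Expected cost of a change of weights\<close>

context closure_matroid
begin

text \<open>The greedy set depends only on which keys are strictly smaller than which; there are
  finitely many such patterns, each a measurable event.\<close>

lemma simple_function_greedy: "simple_function random_tape (\<lambda>\<omega>. greedy (keys q x \<omega>))"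
proof -
  define rel where "rel k = {(i, j). i < m \<and> j < m \<and> k i < k j}" for k :: "nat \<Rightarrow> real"
  have greedy_cong: "greedy k = greedy k'" if "rel k = rel k'" for k k'
  proof -
    have less: "k i < k j \<longleftrightarrow> k' i < k' j" if "i < m" "j < m" for i j
      using \<open>rel k = rel k'\<close> that by (auto simp: rel_def set_eq_iff)
    have "prec k j i \<longleftrightarrow> prec k' j i" if "i < m" "j < m" for i j
      using less[OF that] less[OF that(2,1)] by (auto simp: prec_def)
    then have "below k i = below k' i" if "i < m" for i
      using that by (auto simp: below_def)
    then show ?thesis by (auto simp: greedy_def)
  qed
  \<comment> \<open>\<open>SOME\<close> picks a representative key vector for each pattern,
    exhibiting the greedy set as a function of the pattern.\<close>
  have "greedy k = greedy (SOME k'. rel k' = rel k)" for k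
    by (rule greedy_cong[symmetric]) (rule someI[of "\<lambda>k'. rel k' = rel k" k], rule refl)
  then have eq: "(\<lambda>\<omega>. greedy (keys q x \<omega>)) = (\<lambda>\<omega>. (\<lambda>r. greedy (SOME k'. rel k' = r)) (rel (keys q x \<omega>)))"
    by blast
  have rel_sub: "rel k \<subseteq> {..<m} \<times> {..<m}" for k by (auto simp: rel_def)
  have keys [measurable]: "(\<lambda>\<omega>. keys q x \<omega> i) \<in> borel_measurable random_tape" for i
    unfolding keys_def by measurable
  have "simple_function random_tape (\<lambda>\<omega>. rel (keys q x \<omega>))"
    unfolding simple_function_def
  proof (intro conjI ballI)
    show "finite ((\<lambda>\<omega>. rel (keys q x \<omega>)) ` space random_tape)"
      by (rule finite_subset[of _ "Pow ({..<m} \<times> {..<m})"]) (use rel_sub in auto)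
    fix r assume "r \<in> (\<lambda>\<omega>. rel (keys q x \<omega>)) ` space random_tape"
    then have "r \<subseteq> {..<m} \<times> {..<m}" using rel_sub by blast
    then have "(\<lambda>\<omega>. rel (keys q x \<omega>)) -` {r} \<inter> space random_tape =
        {\<omega> \<in> space random_tape. \<forall>i\<in>{..<m}. \<forall>j\<in>{..<m}. keys q x \<omega> i < keys q x \<omega> j \<longleftrightarrow> (i, j) \<in> r}"
      by (auto simp: rel_def)
    also have "\<dots> \<in> sets random_tape" by measurable
    finally show "(\<lambda>\<omega>. rel (keys q x \<omega>)) -` {r} \<inter> space random_tape \<in> sets random_tape" .
  qed
  then show ?thesis unfolding eq by (rule simple_function_compose1)
qed

lemma measurable_wdist_greedy [measurable]:
  "(\<lambda>\<omega>. ennreal (wdist x (greedy (keys q x \<omega>)) x' (greedy (keys q x' \<omega>)))) \<in> borel_measurable random_tape"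
  by (intro borel_measurable_simple_function
      simple_function_compose2[where h = "\<lambda>I I'. ennreal (wdist x I x' I')"] simple_function_greedy)

lemma nn_integral_wdist_coordinate:
  assumes x: "\<And>i. 0 \<le> x i" and q: "0 < q" "q \<le> 1" and f: "f < m" "x f \<le> b"
    and \<omega>: "\<And>i. 0 \<le> \<omega> i" "\<And>i. \<omega> i \<le> 1"
  shows "(\<integral>\<^sup>+ u. ennreal (wdist x (greedy (keys q x (\<omega> (f := u)))) (x(f := b))
    (greedy (keys q (x(f := b)) (\<omega> (f := u))))) \<partial>unit_uniform) \<le> ennreal (13 / q * (b - x f))"
    (is "(\<integral>\<^sup>+ u. ennreal (?D u) \<partial>_) \<le> _")
proof -
  let ?a = "x f"
  interpret U: prob_space unit_uniform by (rule prob_space_unit_uniform)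
  have b: "0 \<le> b" using x[of f] f by linarith
  have q1: "1 \<le> 1 / q" using q by simp
  let ?in = "\<lambda>u. f \<in> greedy ((keys q x \<omega>)(f := ?a * (1 + q * u))) \<and>
    f \<notin> greedy ((keys q x \<omega>)(f := b * (1 + q * u)))"
  have D: "?D u \<le> (b - ?a) + (if ?in u then 3 * b else 0)" if "0 \<le> u" "u \<le> 1" for u
    using wdist_raise[of x q f b "\<omega> (f := u)", OF x q f] \<omega> that
    by (simp add: keys_upd_weight keys_upd_tape)
  show ?thesis
  \<comment> \<open>For \<open>b < 2 * ?a\<close> the switching interval does the work; otherwise,
    and in particular if \<open>?a = 0\<close>, the trivial bound suffices.\<close>
  proof (cases "b < 2 * ?a")
    case True
    then have a: "0 < ?a" using f by linarith
    let ?d = "2 * (b - ?a) / (?a * q)"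
    have d: "0 \<le> ?d" using a q f by simp
    obtain s where s: "\<And>u. 0 \<le> u \<Longrightarrow> u \<le> 1 \<Longrightarrow> ?in u \<Longrightarrow> u \<in> {s..s + ?d}"
      using switching_interval[OF a f(2) q, of f "keys q x \<omega>"] by metis
    have "(\<integral>\<^sup>+ u. ennreal (?D u) \<partial>unit_uniform) \<le>
        (\<integral>\<^sup>+ u. ennreal (b - ?a) + ennreal (3 * b) * indicator {s..s + ?d} u \<partial>unit_uniform)"
    proof (rule nn_integral_mono_AE, rule AE_mp[OF AE_unit_uniform], rule AE_I2, rule impI)
      fix u :: real assume u: "0 \<le> u \<and> u \<le> 1"
      have "?D u \<le> (b - ?a) + 3 * b * indicator {s..s + ?d} u"
        using D[of u] s[of u] u b by (auto simp: indicator_def split: if_splits)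
      then have "ennreal (?D u) \<le> ennreal ((b - ?a) + 3 * b * indicator {s..s + ?d} u)"
        by (rule ennreal_leI)
      also have "\<dots> = ennreal (b - ?a) + ennreal (3 * b) * indicator {s..s + ?d} u"
        using f b by (auto simp: indicator_def ennreal_plus[symmetric] simp del: ennreal_plus)
      finally show "ennreal (?D u) \<le> ennreal (b - ?a) + ennreal (3 * b) * indicator {s..s + ?d} u" .
    qed
    also have "\<dots> = ennreal (b - ?a) + ennreal (3 * b) * emeasure unit_uniform {s..s + ?d}"
      by (subst nn_integral_add) (auto simp: nn_integral_cmult_indicator U.emeasure_space_1
          intro!: borel_measurable_times_ennreal borel_measurable_indicator)
    also have "\<dots> \<le> ennreal (b - ?a) + ennreal (3 * b) * ennreal ?d"
      by (intro add_left_mono mult_left_mono emeasure_unit_uniform_le d) simp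
    also have "\<dots> = ennreal (b - ?a) + ennreal (3 * b * ?d)"
      using b by (intro arg_cong2[where f = "(+)"] refl ennreal_mult[symmetric] d) simp
    also have "\<dots> = ennreal ((b - ?a) + 3 * b * ?d)"
      using b f by (intro ennreal_plus[symmetric] mult_nonneg_nonneg d) auto
    also have "\<dots> \<le> ennreal (13 / q * (b - ?a))"
    proof (rule ennreal_leI)
      \<comment> \<open>The interval length cancels \<open>?a\<close>: \<open>6 * ?a * ?d\<close> is
        \<open>12 / q * (b - ?a)\<close>, and the remaining \<open>b - ?a\<close> raises 12 to
        13.\<close>
      have "3 * b * ?d \<le> 6 * ?a * ?d" using True d by (intro mult_right_mono) auto
      also have "6 * ?a * ?d = 12 / q * (b - ?a)" using a q by (simp add: field_simps)
      finally have "3 * b * ?d \<le> 12 / q * (b - ?a)" .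
      moreover have "b - ?a \<le> 1 / q * (b - ?a)" using mult_right_mono[OF q1, of "b - ?a"] f by simp
      moreover have "1 / q * (b - ?a) + 12 / q * (b - ?a) = 13 / q * (b - ?a)"
        using q by (simp add: field_simps)
      ultimately show "(b - ?a) + 3 * b * ?d \<le> 13 / q * (b - ?a)" by linarith
    qed
    finally show ?thesis .
  next
    case False
    have "(\<integral>\<^sup>+ u. ennreal (?D u) \<partial>unit_uniform) \<le> (\<integral>\<^sup>+ u. ennreal (13 / q * (b - ?a)) \<partial>unit_uniform)"
    proof (rule nn_integral_mono_AE, rule AE_mp[OF AE_unit_uniform], rule AE_I2, rule impI)
      fix u :: real assume u: "0 \<le> u \<and> u \<le> 1"
      have "?D u \<le> (b - ?a) + 3 * b" using D[of u] u b by (auto split: if_splits)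
      \<comment> \<open>Here \<open>b <= 2 * (b - ?a)\<close>, so the sum is at most 7 times
        \<open>b - ?a\<close>.\<close>
      also have "\<dots> \<le> 13 * (b - ?a)"
      proof -
        have "2 * ?a \<le> b" using False by simp
        moreover have "0 \<le> ?a" by (rule x)
        ultimately show ?thesis by (simp add: algebra_simps)
      qed
      also have "\<dots> \<le> 13 * (1 / q * (b - ?a))"
        using mult_right_mono[OF q1, of "b - ?a"] f(2) by (intro mult_left_mono) simp_all
      finally show "ennreal (?D u) \<le> ennreal (13 / q * (b - ?a))" by (intro ennreal_leI) simp
    qed
    then show ?thesis by (simp add: U.emeasure_space_1)
  qed
qed

lemma nn_integral_wdist_raise:
  assumes x: "\<And>i. 0 \<le> x i" and q: "0 < q" "q \<le> 1" and f: "f < m" "x f \<le> b"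
  shows "(\<integral>\<^sup>+ \<omega>. ennreal (wdist x (greedy (keys q x \<omega>)) (x(f := b)) (greedy (keys q (x(f := b)) \<omega>)))
    \<partial>random_tape) \<le> ennreal (13 / q * (b - x f))"
proof -
  interpret R: prob_space random_tape by (rule prob_space_random_tape)
  have "(\<integral>\<^sup>+ \<omega>. ennreal (wdist x (greedy (keys q x \<omega>)) (x(f := b)) (greedy (keys q (x(f := b)) \<omega>)))
      \<partial>random_tape) \<le> (\<integral>\<^sup>+ \<omega>. ennreal (13 / q * (b - x f)) \<partial>random_tape)"
    by (subst nn_integral_random_tape_resample[where f = f], measurable)
      (rule nn_integral_mono_AE, rule AE_mp[OF AE_random_tape], rule AE_I2, rule impI,
       rule nn_integral_wdist_coordinate[of x q f b, OF x q f], auto)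
  then show ?thesis using R.emeasure_space_1 by simp
qed

lemma nn_integral_wdist_upd:
  assumes x: "\<And>i. 0 \<le> x i" and b: "0 \<le> b" and q: "0 < q" "q \<le> 1" and f: "f < m"
  shows "(\<integral>\<^sup>+ \<omega>. ennreal (wdist x (greedy (keys q x \<omega>)) (x(f := b)) (greedy (keys q (x(f := b)) \<omega>)))
    \<partial>random_tape) \<le> ennreal (13 / q * \<bar>b - x f\<bar>)"
proof (cases "x f \<le> b")
  case True
  then show ?thesis using nn_integral_wdist_raise[of x q f b, OF x q f True] by simp
next
  case False
  \<comment> \<open>Lowering a weight is a raise read backwards, as \<open>wdist\<close> is
    symmetric.\<close>
  have "\<And>i. 0 \<le> (x(f := b)) i" using x b by simp
  from nn_integral_wdist_raise[of "x(f := b)" q f "x f", OF this q f] False show ?thesis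
    by (simp add: wdist_commute[of x])
qed

text \<open>Since both runs share the tape, changing the weights one coordinate at a time only costs a
  triangle inequality, pointwise on the tape.\<close>

lemma nn_integral_wdist:
  assumes x: "\<And>i. 0 \<le> x i" "\<And>i. 0 \<le> x' i" and q: "0 < q" "q \<le> 1"
    and "j \<le> m" "\<And>i. j \<le> i \<Longrightarrow> x i = x' i"
  shows "(\<integral>\<^sup>+ \<omega>. ennreal (wdist x (greedy (keys q x \<omega>)) x' (greedy (keys q x' \<omega>))) \<partial>random_tape)
    \<le> ennreal (13 / q * (\<Sum>i<j. \<bar>x i - x' i\<bar>))"
  using assms(2,5,6)
proof (induction j arbitrary: x')
  case 0
  then have "x' = x" by auto
  then show ?case by simp
next
  case (Suc j)
  let ?y = "x'(j := x j)"
  let ?T = "\<lambda>x \<omega>. greedy (keys q x \<omega>)"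
  have y: "0 \<le> ?y i" for i using Suc.prems(1) x(1) by simp
  have IH: "(\<integral>\<^sup>+ \<omega>. ennreal (wdist x (?T x \<omega>) ?y (?T ?y \<omega>)) \<partial>random_tape)
      \<le> ennreal (13 / q * (\<Sum>i<j. \<bar>x i - ?y i\<bar>))"
    using Suc.prems(2,3) y by (intro Suc.IH) auto
  have step: "(\<integral>\<^sup>+ \<omega>. ennreal (wdist ?y (?T ?y \<omega>) x' (?T x' \<omega>)) \<partial>random_tape)
      \<le> ennreal (13 / q * \<bar>x j - x' j\<bar>)"
    using nn_integral_wdist_upd[of ?y "x' j" q j, OF y] Suc.prems q
    by (simp add: abs_minus_commute)
  have "(\<integral>\<^sup>+ \<omega>. ennreal (wdist x (?T x \<omega>) x' (?T x' \<omega>)) \<partial>random_tape) \<le>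
      (\<integral>\<^sup>+ \<omega>. ennreal (wdist x (?T x \<omega>) ?y (?T ?y \<omega>)) + ennreal (wdist ?y (?T ?y \<omega>) x' (?T x' \<omega>))
        \<partial>random_tape)"
    by (intro nn_integral_mono)
      (simp add: ennreal_plus[symmetric] wdist_triangle ennreal_leI del: ennreal_plus)
  also have "\<dots> = (\<integral>\<^sup>+ \<omega>. ennreal (wdist x (?T x \<omega>) ?y (?T ?y \<omega>)) \<partial>random_tape) +
      (\<integral>\<^sup>+ \<omega>. ennreal (wdist ?y (?T ?y \<omega>) x' (?T x' \<omega>)) \<partial>random_tape)"
    by (rule nn_integral_add) (rule measurable_wdist_greedy)+
  also have "\<dots> \<le> ennreal (13 / q * (\<Sum>i<j. \<bar>x i - ?y i\<bar>)) + ennreal (13 / q * \<bar>x j - x' j\<bar>)"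
    by (intro add_mono IH step)
  also have "\<dots> = ennreal (13 / q * (\<Sum>i<j. \<bar>x i - ?y i\<bar>) + 13 / q * \<bar>x j - x' j\<bar>)"
    using q by (intro ennreal_plus[symmetric] mult_nonneg_nonneg sum_nonneg) auto
  also have "(\<Sum>i<j. \<bar>x i - ?y i\<bar>) = (\<Sum>i<j. \<bar>x i - x' i\<bar>)" by (intro sum.cong) auto
  finally show ?case by (simp add: distrib_left)
qed

end

section \<open>The output distribution\<close>

text \<open>\<open>embed_pmf\<close> is meaningful only for functions of total mass 1. The values of
  probability zero are finitely many, so they are avoided almost surely, and the push-forward is the
  distribution of a genuine \<open>pmf\<close>.\<close>

lemma measure_pmf_embed_simple_function:
  assumes "prob_space M" and X: "simple_function M X"
  shows "measure_pmf (embed_pmf (\<lambda>x. measure M {\<omega> \<in> space M. X \<omega> = x})) = distr M (count_space UNIV) X"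
proof -
  interpret prob_space M by fact
  have [measurable]: "X \<in> measurable M (count_space UNIV)"
    using X by (rule measurable_simple_function)
  let ?D = "distr M (count_space UNIV) X"
  have D: "measure ?D {x} = measure M {\<omega> \<in> space M. X \<omega> = x}" for x
    by (subst measure_distr) (auto intro!: arg_cong[where f = "measure M"])
  have "AE \<omega> in M. measure ?D {X \<omega>} \<noteq> 0"
  proof (rule AE_I')
    let ?N = "\<Union>x\<in>{x \<in> X ` space M. measure ?D {x} = 0}. {\<omega> \<in> space M. X \<omega> = x}"
    show "?N \<in> null_sets M"
    proof (rule null_sets_UN')
      show "countable {x \<in> X ` space M. measure ?D {x} = 0}"
        using simple_functionD(1)[OF X] by (intro countable_finite) simp
      fix x assume "x \<in> {x \<in> X ` space M. measure ?D {x} = 0}"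
      then show "{\<omega> \<in> space M. X \<omega> = x} \<in> null_sets M"
        by (intro null_setsI) (auto simp: D emeasure_eq_measure)
    qed
    show "{\<omega> \<in> space M. \<not> measure ?D {X \<omega>} \<noteq> 0} \<subseteq> ?N" by auto
  qed
  then have "?D \<in> {M. prob_space M \<and> sets M = UNIV \<and> (AE x in M. measure M {x} \<noteq> 0)}"
    by (auto simp: AE_distr_iff intro!: prob_space_distr)
  then have rep: "measure_pmf (Abs_pmf ?D) = ?D" by (rule Abs_pmf_inverse)
  have "embed_pmf (\<lambda>x. measure M {\<omega> \<in> space M. X \<omega> = x}) = embed_pmf (pmf (Abs_pmf ?D))"
    by (simp add: pmf.rep_eq rep D)
  also have "\<dots> = Abs_pmf ?D"
    by (rule type_definition.Rep_inverse[OF td_pmf_embed_pmf])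
  finally show ?thesis using rep by simp
qed

abbreviation random_tree :: "rat \<Rightarrow> (nat \<times> nat) list \<Rightarrow> (nat set \<Rightarrow> real) \<Rightarrow> (nat \<Rightarrow> real) \<Rightarrow> nat set" where
  "random_tree q es w \<omega> \<equiv> greedy_tree es (keys (of_rat q) (weights es w) \<omega>)"

text \<open>Termination and determinism of \<open>exec\<close> turn the output event into an event
  about the greedy tree.\<close>

lemma measure_pmf_output_mst_program:
  "measure_pmf (output_pmf (mst_program q) n es w) =
    distr random_tape (count_space UNIV) (\<lambda>\<omega>. edges es (random_tree q es w \<omega>))"
proof -
  have "(\<exists>t s. exec \<omega> (mst_program q) (init_state n es w) t s \<and> output_edges es s = F) \<longleftrightarrow>
      edges es (random_tree q es w \<omega>) = F" for \<omega> F
  proof -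
    obtain t s where "exec \<omega> (mst_program q) (init_state n es w) t s"
      "output_edges es s = edges es (random_tree q es w \<omega>)"
      using runs_mst_program[of \<omega> q n es w] unfolding runs_def by blast
    then show ?thesis using exec_deterministic by blast
  qed
  then show ?thesis
    unfolding output_pmf_def
    by (simp only: measure_pmf_embed_simple_function[OF prob_space_random_tape
        simple_function_compose1[OF graphic.simple_function_greedy]])
qed

lemma weights_nonneg:
  assumes "input_graph n E es" "w \<in> weight_vectors E"
  shows "0 \<le> weights es w i"
  using assms edges_all[OF assms(1)] by (auto simp: weights_def weight_vectors_def edges_def)

lemma mst_approximation_mst_program:
  assumes q: "0 < q" "of_rat q \<le> \<epsilon>"
  shows "mst_approximation (1 + \<epsilon>) (mst_program q)"
  unfolding mst_approximation_def
proof (intro allI impI ballI)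
  fix n E es w T
  assume G: "input_graph n E es" and w: "w \<in> weight_vectors E"
    and T: "T \<in> set_pmf (output_pmf (mst_program q) n es w)"
  interpret R: prob_space random_tape by (rule prob_space_random_tape)
  let ?X = "\<lambda>\<omega>. edges es (random_tree q es w \<omega>)"
  have [measurable]: "?X \<in> measurable random_tape (count_space UNIV)"
    by (intro measurable_simple_function simple_function_compose1[OF graphic.simple_function_greedy])
  \<comment> \<open>The approximation guarantee is available for tapes with entries in the unit
    interval. A tree in the support has positive probability, so some such tape produces it.\<close>
  have "\<not> (AE \<omega> in random_tape. ?X \<omega> \<noteq> T)"
  proof
    assume "AE \<omega> in random_tape. ?X \<omega> \<noteq> T"
    then have "AE F in measure_pmf (output_pmf (mst_program q) n es w). F \<noteq> T"
      unfolding measure_pmf_output_mst_program by (subst AE_distr_iff) auto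
    then show False using T by (auto simp: AE_measure_pmf_iff)
  qed
  moreover have "AE \<omega> in random_tape. ?X \<omega> \<noteq> T"
    if "\<And>\<omega>. (\<forall>i. 0 \<le> \<omega> i \<and> \<omega> i \<le> 1) \<Longrightarrow> ?X \<omega> \<noteq> T"
    using AE_random_tape by eventually_elim (rule that)
  ultimately obtain \<omega> where \<omega>: "\<forall>i. 0 \<le> \<omega> i \<and> \<omega> i \<le> 1" "?X \<omega> = T"
    by blast
  let ?q = "real_of_rat q" and ?k = "keys (of_rat q) (weights es w) \<omega>"
  have q0: "0 < ?q" using q by simp
  have w0: "0 \<le> w (pair_edge (es ! i))" if "i < length es" for i
    using weights_nonneg[OF G w, of i] that by (simp add: weights_def)
  have "sum w T \<le> (1 + ?q) * mst_opt {..<n} E w"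
    unfolding \<omega>(2)[symmetric]
  proof (rule greedy_tree_approx[where w = w, OF G less_imp_le[OF q0] w0])
    fix i assume i: "i < length es"
    have qw: "0 \<le> ?q * \<omega> i" "?q * \<omega> i \<le> ?q"
      using q0 \<omega>(1) by (auto simp: mult_left_le)
    have k: "?k i = w (pair_edge (es ! i)) * (1 + ?q * \<omega> i)"
      using i by (simp add: keys_def weights_def)
    show "w (pair_edge (es ! i)) \<le> ?k i"
      using mult_left_mono[OF qw(1) w0[OF i]] by (simp add: k algebra_simps)
    show "?k i \<le> (1 + ?q) * w (pair_edge (es ! i))"
      using mult_left_mono[OF qw(2) w0[OF i]] by (simp add: k algebra_simps)
  qed
  also have "\<dots> \<le> (1 + \<epsilon>) * mst_opt {..<n} E w"
  proof (rule mult_right_mono)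
    \<comment> \<open>Nonnegativity of the optimum, which justifies enlarging \<open>?q\<close> to
      \<epsilon>, is read off from the bound just proved.\<close>
    have "0 \<le> sum w T" unfolding \<omega>(2)[symmetric] sum_edges[OF G graphic.greedy_subset]
      using w0 graphic.greedy_subset by (intro sum_nonneg) blast
    then have "0 \<le> (1 + ?q) * mst_opt {..<n} E w" using calculation by linarith
    then show "0 \<le> mst_opt {..<n} E w" using q0 by (simp add: zero_le_mult_iff)
  qed (use q in simp)
  finally show "spanning_tree {..<n} E T \<and> sum w T \<le> (1 + \<epsilon>) * mst_opt {..<n} E w"
    using greedy_tree_spanning_tree[OF G] \<omega>(2) by blast
qed

section \<open>Coupling through a common tape\<close>

lemma dist_w_edges:
  assumes G: "input_graph n E es" and I: "I \<subseteq> {..<length es}" "I' \<subseteq> {..<length es}"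
  shows "dist_w E (edges es I) w (edges es I') w' =
    closure_matroid.wdist (length es) (weights es w) I (weights es w') I'"
proof -
  have ind: "indicator (edges es A) (pair_edge (es ! i)) = (indicator A i :: real)"
    if "i < length es" "A \<subseteq> {..<length es}" for A i
  proof -
    have "pair_edge (es ! i) \<in> edges es A \<longleftrightarrow> i \<in> A"
      using inj_on_image_mem_iff[OF inj_on_pair_edge[OF G] _ that(2), of i] that(1) by (simp add: edges_def)
    then show ?thesis by (simp add: indicator_def)
  qed
  have "dist_w E (edges es I) w (edges es I') w' = (\<Sum>i<length es.
      \<bar>w (pair_edge (es ! i)) * indicator (edges es I) (pair_edge (es ! i)) -
       w' (pair_edge (es ! i)) * indicator (edges es I') (pair_edge (es ! i))\<bar>)"
    unfolding dist_w_def edges_all[OF G, symmetric] by (rule sum_edges[OF G order_refl])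
  also have "\<dots> = closure_matroid.wdist (length es) (weights es w) I (weights es w') I'"
    unfolding graphic.wdist_def using I by (intro sum.cong) (auto simp: ind weights_def)
  finally show ?thesis .
qed

lemma EM_w_mst_program:
  assumes G: "input_graph n E es" and w: "w \<in> weight_vectors E" "w' \<in> weight_vectors E"
    and q: "0 < q" "q \<le> 1"
  shows "EM_w E (output_pmf (mst_program q) n es w) w (output_pmf (mst_program q) n es w') w' \<le>
    ennreal (13 / of_rat q * (\<Sum>e\<in>E. \<bar>w e - w' e\<bar>))"
proof -
  let ?X = "\<lambda>w \<omega>. edges es (random_tree q es w \<omega>)"
  let ?P = "\<lambda>\<omega>. (?X w \<omega>, ?X w' \<omega>)"
  \<comment> \<open>The joint law of both outputs on one shared tape; its marginals are the two
    output distributions.\<close>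
  define \<pi> where "\<pi> = embed_pmf (\<lambda>p. measure random_tape {\<omega> \<in> space random_tape. ?P \<omega> = p})"
  have X: "simple_function random_tape (?X w)" for w
    by (rule simple_function_compose1[OF graphic.simple_function_greedy])
  have P: "simple_function random_tape ?P"
    by (rule simple_function_Pair[OF X X])
  have \<pi>: "measure_pmf \<pi> = distr random_tape (count_space UNIV) ?P"
    unfolding \<pi>_def by (rule measure_pmf_embed_simple_function[OF prob_space_random_tape P])
  note P' = measurable_simple_function[OF P]
  have "map_pmf fst \<pi> = output_pmf (mst_program q) n es w"
    by (simp add: measure_pmf_inject[symmetric] map_pmf_rep_eq \<pi> measure_pmf_output_mst_program
        distr_distr[OF _ P'] comp_def)
  moreover have "map_pmf snd \<pi> = output_pmf (mst_program q) n es w'"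
    by (simp add: measure_pmf_inject[symmetric] map_pmf_rep_eq \<pi> measure_pmf_output_mst_program
        distr_distr[OF _ P'] comp_def)
  ultimately have "EM_w E (output_pmf (mst_program q) n es w) w (output_pmf (mst_program q) n es w') w' \<le>
      (\<integral>\<^sup>+ (F, F'). ennreal (dist_w E F w F' w') \<partial>measure_pmf \<pi>)"
    unfolding EM_w_def by (intro INF_lower) (simp add: couplings_def)
  also have "\<dots> = (\<integral>\<^sup>+ \<omega>. ennreal (dist_w E (?X w \<omega>) w (?X w' \<omega>) w') \<partial>random_tape)"
    unfolding \<pi> by (subst nn_integral_distr[OF P']) auto
  also have "\<dots> \<le> ennreal (13 / of_rat q * (\<Sum>i<length es. \<bar>weights es w i - weights es w' i\<bar>))"
    unfolding dist_w_edges[OF G graphic.greedy_subset graphic.greedy_subset]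
    using q weights_nonneg[OF G] w
    by (intro graphic.nn_integral_wdist) (auto simp: weights_def)
  also have "(\<Sum>i<length es. \<bar>weights es w i - weights es w' i\<bar>) = (\<Sum>e\<in>E. \<bar>w e - w' e\<bar>)"
    unfolding edges_all[OF G, symmetric] sum_edges[OF G order_refl]
    by (intro sum.cong) (auto simp: weights_def)
  finally show ?thesis .
qed

lemma lipschitz_const_mst_program:
  assumes G: "input_graph n E es" and q: "0 < q" "q \<le> 1"
  shows "lipschitz_const E (output_pmf (mst_program q) n es) \<le> ennreal (13 / of_rat q)"
  unfolding lipschitz_const_def
proof (rule SUP_least, clarify)
  fix w w' assume w: "w \<in> weight_vectors E" "w' \<in> weight_vectors E" "w \<noteq> w'"
  let ?d = "\<Sum>e\<in>E. \<bar>w e - w' e\<bar>"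
  have fin: "finite E" using edges_all[OF G] by (auto simp: edges_def)
  \<comment> \<open>Weight vectors are extensional, so distinct ones differ on an edge of
    \<open>E\<close> and the denominator is positive.\<close>
  obtain e where "e \<in> E" "w e \<noteq> w' e"
    using w unfolding weight_vectors_def by (metis PiE_ext)
  then have "0 < ?d" using fin by (intro sum_pos2[of E e]) auto
  moreover have "ennreal (13 / of_rat q * ?d) = ennreal ?d * ennreal (13 / of_rat q)"
    using q by (simp add: ennreal_mult'[symmetric] sum_nonneg mult.commute)
  ultimately show "EM_w E (output_pmf (mst_program q) n es w) w (output_pmf (mst_program q) n es w') w' /
      ennreal ?d \<le> ennreal (13 / of_rat q)"
    using EM_w_mst_program[OF G w(1,2) q] by (intro divide_le_posI_ennreal) auto
qed

theorem theorem2p1: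
  shows "\<exists>C::real. 0 < C \<and> (\<forall>\<epsilon>::real. 0 < \<epsilon> \<longrightarrow>
    (\<exists>P. polynomial_time P \<and> mst_approximation (1 + \<epsilon>) P \<and>
      (\<forall>n E es. input_graph n E es \<longrightarrow>
        lipschitz_const E (output_pmf P n es) \<le> ennreal (C / min 1 \<epsilon>))))"
\<comment> \<open>26 is twice 13, as \<open>q\<close> is chosen above half of
  \<open>min 1 \<epsilon>\<close>. The cap at 1 keeps \<open>q <= 1\<close>, which the sensitivity
  bounds assume.\<close>
proof (intro exI[of _ 26] conjI allI impI)
  fix \<epsilon> :: real assume \<epsilon>: "0 < \<epsilon>"
  let ?e = "min 1 \<epsilon>"
  have e: "0 < ?e" using \<epsilon> by simp
  then have "?e / 2 < ?e" by linarith
  \<comment> \<open>Program constants are rational, so \<open>q\<close> is found by density.\<close>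
  then obtain q :: rat where q: "?e / 2 < of_rat q" "of_rat q < ?e"
    using of_rat_dense by blast
  have q0: "0 < real_of_rat q" using q(1) e by linarith
  then have q': "0 < q" "q \<le> 1" using q(2) by (simp_all add: of_rat_less_1_iff less_imp_le)
  have "13 / real_of_rat q \<le> 26 / min 1 \<epsilon>"
    using q(1) q0 e by (simp add: field_simps)
  then have "lipschitz_const E (output_pmf (mst_program q) n es) \<le> ennreal (26 / min 1 \<epsilon>)"
    if "input_graph n E es" for n E es
    using lipschitz_const_mst_program[OF that q'] ennreal_leI order_trans by blast
  then show "\<exists>P. polynomial_time P \<and> mst_approximation (1 + \<epsilon>) P \<and>
      (\<forall>n E es. input_graph n E es \<longrightarrow>
        lipschitz_const E (output_pmf P n es) \<le> ennreal (26 / min 1 \<epsilon>))"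
    using polynomial_time_mst_program mst_approximation_mst_program[OF q'(1), of \<epsilon>] q(2)
    by (intro exI[of _ "mst_program q"] conjI allI impI) auto
qed simp

end
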